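(* Let $q,p\in\mathbb{N}$ (positive integers). Let $(\xi,\eta)\in V_1\setminus\{0\}$ and $\tau\in\mathbb{R}^q\setminus\{0\}$, and assume that $|\eta|+|P_\tau\xi|>0$. Then the length-extremal $s\mapsto\gamma(s,\xi,\eta,\tau)$ with $\gamma(0,\xi,\eta,\tau)=(0,0,0)$ minimizes length up to $$t_{\rm cut}(\xi,\eta,\tau)=\frac{2\pi}{|\tau|}.$$ Consequently, the cut points of the origin are exactly the points of the form $\gamma\big(\tfrac{2\pi}{|\tau|},\xi,\eta,\tau\big)$ with $(\xi,\eta,\tau)$ satisfying the previous requirements (that is, $(\xi,\eta)\ne 0$, $\tau\neq 0$ and $|\eta|+|P_\tau\xi|>0$).
   Context: Group. For positive integers $q,p$ let $V_1=\mathbb{R}^{q\times p}\times\mathbb{R}^{p\times 1}$, $V_2=\mathbb{R}^{q\times 1}$ and let $\mathbb{G}_{qp}=V_1\times V_2$ be the step-2 Carnot group (Reiter-Heisenberg group) with product $(x,y,t)\cdot(\xi,\eta,\tau)=\big(x+\xi,\,y+\eta,\,t+\tau+Q((x,y),(\xi,\eta))\big)$, where $Q((x,y),(\xi,\eta))=\tfrac12(x\eta-\xi y)$. On $V_1$ use the inner product $\langle(x,y),(\xi,\eta)\rangle=\operatorname{trace}(x^T\xi)+y^T\eta$; all matrix norms are Hilbert-Schmidt norms. Horizontal curves and length. A horizontal curve is a Lipschitz curve $\gamma=(x,y,t):[0,T]\to V_1\times V_2$ with $(\dot x,\dot y)=(u,v)$ and $\dot t=Q((x,y),(u,v))$ a.e.,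 for some $L^\infty$ control $(u,v):[0,T]\to V_1$. Its length is $\int_0^T\sqrt{|u|^2+|v|^2}\,ds$. The sub-Riemannian distance is the infimum of lengths of horizontal curves joining two points; a horizontal curve minimizes length on $[0,\bar s]$ if its length on $[0,\bar s]$ equals the distance between its endpoints. Extremals. For $\tau\in\mathbb{R}^q$ let $A_\tau:V_1\to V_1$, $A_\tau(\xi,\eta)=(\tau\eta^T,-\xi^T\tau)$. For $(\xi,\eta,\tau)\in V_1\times V_2\simeq T^*_{(0,0,0)}\mathbb{G}_{qp}$, the length-extremal $\gamma(\cdot,\xi,\eta,\tau):\mathbb{R}\to V_1\times V_2$ is the horizontal curve with $\gamma(0,\xi,\eta,\tau)=(0,0,0)$ and control $(u(s),v(s))=e^{-sA_\tau}(\xi,\eta)$ (equivalently, the projection of the solution of the sub-Riemannian normal Hamiltonian system with initial point the origin and initial covector $(\xi,\eta,\tau)$). Its constant speed is $\sqrt{|\xi|^2+|\eta|^2}$. Cut time and cut points. For $(\xi,\eta)\neq0$, $t_{\rm cut}(\xi,\eta,\tau)=\sup\{\bar s>0:\gamma(\cdot,\xi,\eta,\tau)\text{ minimizes length on }[0,\bar s]\}\in\,]0,+\infty]$. The cut points of the origin are the points $\gamma(t_{\rm cut}(\xi,\eta,\tau),\xi,\eta,\tau)$ with $(\xi,\eta)\ne0$ and $t_{\rm cut}(\xi,\eta,\tau)<+\infty$. Projections. For $\tau\in\mathbb{R}^q\setminus\{0\}$, $P_\tau=\frac{\tau\tau^T}{|\tau|^2}\in\mathbb{R}^{q\times q}$;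 $P_\tau\xi$ is the matrix product (it projects each column of $\xi$). *)

theory Defs
  imports "HOL-Analysis.Analysis"
begin

text \<open>
  A \<open>q \<times> p\<close> matrix has type \<^typ>\<open>real^'p^'q\<close>, so its norm is the Hilbert-Schmidt norm and the
  inner product of the product type is \<open>trace(x\<^sup>T \<xi>) + y\<^sup>T \<eta>\<close>. The index types are nonempty and
  finite but otherwise arbitrary, hence stand for arbitrary positive integers \<open>q\<close> and \<open>p\<close>.
\<close>

type_synonym ('q, 'p) layer1 = "(real^'p^'q) \<times> (real^'p)"
type_synonym ('q, 'p) carnot = "('q, 'p) layer1 \<times> (real^'q)"

definition Qform ::
    "('q::finite, 'p::finite) layer1 \<Rightarrow> ('q, 'p) layer1 \<Rightarrow> real^'q" where
  "Qform z w = (1/2) *\<^sub>R (fst z *v snd w - fst w *v snd z)"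

definition carnot_mult ::
    "('q::finite, 'p::finite) carnot \<Rightarrow> ('q, 'p) carnot \<Rightarrow> ('q, 'p) carnot" where
  "carnot_mult g h = (fst g + fst h, snd g + snd h + Qform (fst g) (fst h))"

definition horizontal ::
    "real \<Rightarrow> (real \<Rightarrow> ('q::finite, 'p::finite) carnot) \<Rightarrow> (real \<Rightarrow> ('q, 'p) layer1) \<Rightarrow> bool" where
  "horizontal T \<gamma> w \<longleftrightarrow>
     (\<exists>L. L-lipschitz_on {0..T} \<gamma>) \<and>
     w \<in> borel_measurable (lebesgue_on {0..T}) \<and>
     (\<exists>B. AE s in lebesgue_on {0..T}. norm (w s) \<le> B) \<and>
     (AE s in lebesgue_on {0..T}.
        (\<gamma> has_vector_derivative (w s, Qform (fst (\<gamma> s)) (w s))) (at s within {0..T}))"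

text \<open>
  A horizontal curve determines its control almost everywhere, so the length of the curve can be
  written as a function of the control.
\<close>

definition horizontal_length :: "real \<Rightarrow> (real \<Rightarrow> ('q::finite, 'p::finite) layer1) \<Rightarrow> real" where
  "horizontal_length T w =
     (LINT s|lebesgue_on {0..T}. sqrt ((norm (fst (w s)))\<^sup>2 + (norm (snd (w s)))\<^sup>2))"

text \<open>
  The set of lengths is bounded below by 0, and it is nonempty since the first layer
  generates the Lie algebra (Chow's theorem).
\<close>

definition sr_dist :: "('q::finite, 'p::finite) carnot \<Rightarrow> ('q, 'p) carnot \<Rightarrow> real" where
  "sr_dist a b =
     Inf {horizontal_length T w | T \<gamma> w. 0 < T \<and> horizontal T \<gamma> w \<and> \<gamma> 0 = a \<and> \<gamma> T = b}"

definition minimizes_length :: "(real \<Rightarrow> ('q::finite, 'p::finite) carnot) \<Rightarrow> real \<Rightarrow> bool" where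
  "minimizes_length \<gamma> s \<longleftrightarrow>
     (\<exists>w. horizontal s \<gamma> w \<and> horizontal_length s w = sr_dist (\<gamma> 0) (\<gamma> s))"

definition outer :: "real^'m::finite \<Rightarrow> real^'n::finite \<Rightarrow> real^'n^'m" where
  "outer a b = (\<chi> i j. a $ i * b $ j)"

definition Aop ::
    "real^'q::finite \<Rightarrow> ('q, 'p::finite) layer1 \<Rightarrow> ('q, 'p) layer1" where
  "Aop \<tau> z = (outer \<tau> (snd z), - (transpose (fst z) *v \<tau>))"

text \<open>
  The exponential \<open>e\<^sup>A v\<close> of a linear endomorphism \<open>A\<close>, applied to \<open>v\<close>. The library's \<^const>\<open>exp\<close>
  needs a normed algebra type, which linear endomorphisms do not form.
\<close>

definition exp_op :: "('a::euclidean_space \<Rightarrow> 'a) \<Rightarrow> 'a \<Rightarrow> 'a" where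
  "exp_op A v = (\<Sum>n. (A ^^ n) v /\<^sub>R fact n)"

definition extremal_control ::
    "real^'p::finite^'q::finite \<Rightarrow> real^'p \<Rightarrow> real^'q \<Rightarrow> real \<Rightarrow> ('q, 'p) layer1" where
  "extremal_control \<xi> \<eta> \<tau> s = exp_op (\<lambda>z. - s *\<^sub>R Aop \<tau> z) (\<xi>, \<eta>)"

text \<open>
  The horizontal curve on the real line that starts at the origin and has the control above,
  obtained by integrating first \<open>(x, y)\<close> and then \<open>t\<close>. The interval integral is signed, so the
  formula also covers negative times.
\<close>

definition extremal_layer1 ::
    "real^'p::finite^'q::finite \<Rightarrow> real^'p \<Rightarrow> real^'q \<Rightarrow> real \<Rightarrow> ('q, 'p) layer1" where
  "extremal_layer1 \<xi> \<eta> \<tau> s = (LBINT r=0..s. extremal_control \<xi> \<eta> \<tau> r)"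

definition extremal ::
    "real^'p::finite^'q::finite \<Rightarrow> real^'p \<Rightarrow> real^'q \<Rightarrow> real \<Rightarrow> ('q, 'p) carnot" where
  "extremal \<xi> \<eta> \<tau> s =
     (extremal_layer1 \<xi> \<eta> \<tau> s,
      LBINT r=0..s. Qform (extremal_layer1 \<xi> \<eta> \<tau> r) (extremal_control \<xi> \<eta> \<tau> r))"

definition cut_time ::
    "real^'p::finite^'q::finite \<Rightarrow> real^'p \<Rightarrow> real^'q \<Rightarrow> ereal" where
  "cut_time \<xi> \<eta> \<tau> = Sup (ereal ` {s. 0 < s \<and> minimizes_length (extremal \<xi> \<eta> \<tau>) s})"

definition cut_points :: "('q::finite, 'p::finite) carnot set" where
  "cut_points =
     {extremal \<xi> \<eta> \<tau> t | \<xi> \<eta> \<tau> t. (\<xi>, \<eta>) \<noteq> 0 \<and> cut_time \<xi> \<eta> \<tau> = ereal t}"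

definition Pproj :: "real^'q::finite \<Rightarrow> real^'q^'q" where
  "Pproj \<tau> = outer \<tau> \<tau> /\<^sub>R (norm \<tau>)\<^sup>2"

end

theory Submission
  imports Defs
begin

text \<open>
  Write \<open>A = Aop \<tau>\<close>, \<open>\<omega> = norm \<tau>\<close> and \<open>T = 2 pi / \<omega>\<close>. The operator \<open>A\<close> is skew and satisfies
  \<open>A\<^sup>3 = - \<omega>\<^sup>2 A\<close>, so the control \<open>w\<close> of an extremal rotates with angular speed \<open>\<omega>\<close> in the range of
  \<open>A\<close>, is constant on its kernel, and solves \<open>w' = - A w\<close>. If the initial velocity lies in the kernel, the extremal is a straight
  line and minimizes forever (\<open>minimizes_degenerate\<close>). For \<open>\<tau> \<noteq> 0\<close> this is the case that the condition
  on \<open>\<eta>\<close> and \<open>P\<^sub>\<tau> \<xi>\<close> excludes (\<open>Aop_eq_0_iff\<close>), and for \<open>\<tau> = 0\<close> it always occurs.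

  Consider another horizontal curve with the same endpoints, parametrized over the same time interval, and
  let \<open>\<delta>\<close> be the difference of the horizontal parts, a loop. The derivative of the vertical
  component satisfies \<open>\<tau> \<bullet> t' = (z \<bullet> A z') / 2\<close>, so the equality of the vertical endpoints in
  the direction \<open>\<tau>\<close> is a scalar quadratic constraint. Using it to eliminate the first
  variation gives an exact formula: the energy of the competitor minus the energy of the extremal is
  the integral of \<open>(norm \<delta>')\<^sup>2 - \<delta> \<bullet> A \<delta>'\<close>. After a rotation of \<open>\<delta>\<close> by the angle \<open>\<omega> s / 2\<close> the integrand becomes
  \<open>(norm g')\<^sup>2 - (\<omega> / 2)\<^sup>2 (norm g)\<^sup>2\<close> on the range of \<open>A\<close>, and the Wirtinger inequality for functions that vanish at the endpoints
  makes the integral nonnegative exactly as long as the duration is at most \<open>T\<close>.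

  Both halves of the theorem rest on this formula. For minimality on \<open>{0..T}\<close>, the Wirtinger
  inequality is proved by completing a square with a solution of the Riccati equation
  (\<open>completed_square\<close>, \<open>shifted_cot\<close>), and energy is replaced by length through
  time changes that make the competitor almost of constant speed (\<open>weighted_energy_lower_bound\<close>,
  \<open>length_lower_bound\<close>). For the failure of minimality after \<open>T\<close>, a circular loop \<open>\<delta>\<close>
  traversed once in a time longer than \<open>T\<close> makes the integral negative, and its radius can be chosen
  so that all components of the vertical endpoint are preserved (\<open>shorter_competitor\<close>).
\<close>

section \<open>Lipschitz functions on an interval\<close>

text \<open>
  The fundamental theorem of calculus for Lipschitz functions. The difference quotients are bounded
  by the Lipschitz constant, so their integrals converge to the integral of the derivative; on the
  other hand these integrals are differences of means of \<open>f\<close> over short intervals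
  at \<open>b\<close> and at \<open>a\<close>, which converge to \<open>f b\<close> and \<open>f a\<close>.
\<close>
lemma lipschitz_has_integral_derivative:
  fixes f h :: "real \<Rightarrow> real"
  assumes ab: "a \<le> b" and lip: "L-lipschitz_on {a..b} f" and N: "negligible N"
    and der: "\<And>x. x \<in> {a..b} - N \<Longrightarrow> (f has_real_derivative h x) (at x within {a..b})"
  shows "(h has_integral (f b - f a)) {a..b}"
proof -
  \<comment> \<open>The constant extension beyond the interval makes all difference quotients meaningful.\<close>
  define F where "F x = f (max a (min b x))" for x
  define e where "e n = 1 / real (Suc n)" for n
  define D where "D n x = (F (x + e n) - F x) / e n" for n x
  have e0: "e n > 0" "e n \<le> 1" for n by (auto simp: e_def field_simps)
  have elim: "e \<longlonglongrightarrow> 0"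
    unfolding e_def using LIMSEQ_inverse_real_of_nat by (simp add: inverse_eq_divide)
  have L0: "L \<ge> 0" using lip by (rule lipschitz_on_nonneg)
  have Flip: "\<bar>F x - F y\<bar> \<le> L * \<bar>x - y\<bar>" for x y
  proof -
    have "\<bar>F x - F y\<bar> \<le> L * \<bar>max a (min b x) - max a (min b y)\<bar>"
      using lipschitz_onD[OF lip, of "max a (min b x)" "max a (min b y)"] ab
      by (auto simp: F_def dist_real_def)
    also have "\<dots> \<le> L * \<bar>x - y\<bar>"
      using L0 ab by (intro mult_left_mono) (auto simp: max_def min_def)
    finally show ?thesis .
  qed
  have Fcont: "continuous_on X F" for X
    by (rule continuous_on_subset[OF lipschitz_on_continuous_on[of L UNIV]])
       (auto intro!: lipschitz_onI simp: dist_real_def Flip L0)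
  define P where "P x = integral {a - 1..x} F" for x
  have P: "(P has_real_derivative F x) (at x)" if "x \<in> {a..b + 1}" for x
  proof -
    have "(P has_real_derivative F x) (at x within {a - 1..b + 2})"
      unfolding P_def using that by (intro integral_has_real_derivative Fcont) auto
    moreover have "at x within {a - 1..b + 2} = at x"
      by (rule at_within_interior) (use that in auto)
    ultimately show ?thesis by simp
  qed
  \<comment> \<open>The integral of a difference quotient, computed with the antiderivative \<open>P\<close> of \<open>F\<close>.\<close>
  define I where "I n = (P (b + e n) - P b) / e n - (P (a + e n) - P a) / e n" for n
  have DI: "(D n has_integral I n) {a..b}" for n
  proof -
    have "(D n has_integral (\<lambda>x. (P (x + e n) - P x) / e n) b - (\<lambda>x. (P (x + e n) - P x) / e n) a) {a..b}"
    proof (rule fundamental_theorem_of_calculus[OF ab])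
      fix x assume x: "x \<in> {a..b}"
      have "((\<lambda>x. P (x + e n)) has_real_derivative F (x + e n)) (at x)"
        using P[of "x + e n"] x e0[of n] by (simp add: DERIV_shift)
      then have "((\<lambda>x. (P (x + e n) - P x) / e n) has_real_derivative D n x) (at x)"
        unfolding D_def using P[of x] x by (intro DERIV_cdivide DERIV_diff) auto
      then show "((\<lambda>x. (P (x + e n) - P x) / e n) has_vector_derivative D n x) (at x within {a..b})"
        by (simp add: has_real_derivative_iff_has_vector_derivative has_vector_derivative_at_within)
    qed
    then show ?thesis by (simp add: I_def)
  qed
  have Plim: "(\<lambda>n. (P (c + e n) - P c) / e n) \<longlonglongrightarrow> F c" if "c \<in> {a..b + 1}" for c
  proof -
    have "((\<lambda>h. (P (c + h) - P c) / h) \<longlongrightarrow> F c) (at 0)"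
      using P[OF that] by (simp add: DERIV_def)
    moreover have "filterlim e (at 0) sequentially"
      using elim e0(1) by (auto simp: filterlim_at intro!: always_eventually less_imp_neq[symmetric])
    ultimately show ?thesis by (rule filterlim_compose)
  qed
  have Ilim: "I \<longlonglongrightarrow> f b - f a"
    unfolding I_def using Plim[of b] Plim[of a] ab by (auto intro!: tendsto_diff simp: F_def)
  \<comment> \<open>At \<open>b\<close> the right difference quotients of the constant extension vanish, so \<open>b\<close> joins the null set.\<close>
  have neg: "negligible (insert b N)" using N by simp
  let ?g = "\<lambda>x. if x \<in> insert b N then 0 else h x"
  have conv: "(\<lambda>n. if x \<in> insert b N then 0 else D n x) \<longlonglongrightarrow> ?g x" if "x \<in> {a..b}" for x
  proof (cases "x \<in> insert b N")
    case False
    then have x: "a \<le> x" "x < b" "x \<notin> N" using that by auto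
    define X where "X n = min b (x + e n)" for n
    have Xlim: "X \<longlonglongrightarrow> x"
      using tendsto_min[OF tendsto_const tendsto_add[OF tendsto_const elim], of b x] x
      by (simp add: X_def[abs_def])
    have "((\<lambda>y. (f y - f x) / (y - x)) \<longlongrightarrow> h x) (at x within {a..b})"
      using der[of x] x by (simp add: has_field_derivative_iff)
    then have "((\<lambda>y. (f y - f x) / (y - x)) \<circ> X) \<longlonglongrightarrow> h x"
      unfolding tendsto_at_iff_sequentially using Xlim x e0(1)
      by (auto simp: X_def min_def less_imp_neq[symmetric] add_increasing2 less_imp_le)
    moreover have "\<forall>\<^sub>F n in sequentially. e n < b - x"
      using order_tendstoD(2)[OF elim, of "b - x"] x by simp
    then have "\<forall>\<^sub>F n in sequentially. ((\<lambda>y. (f y - f x) / (y - x)) \<circ> X) n = D n x"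
    proof eventually_elim
      case (elim n)
      then show ?case using x e0(1)[of n] by (simp add: X_def D_def F_def)
    qed
    ultimately have "(\<lambda>n. D n x) \<longlonglongrightarrow> h x" by (rule Lim_transform_eventually)
    then show ?thesis using False by simp
  qed auto
  have DI': "((\<lambda>x. if x \<in> insert b N then 0 else D n x) has_integral I n) {a..b}" for n
    by (rule has_integral_spike[OF neg _ DI]) auto
  have bnd: "norm (if x \<in> insert b N then 0 else D n x) \<le> L" for n x
    using Flip[of "x + e n" x] e0(1)[of n] L0 by (auto simp: D_def divide_simps abs_mult)
  note dc = dominated_convergence[of "\<lambda>n x. if x \<in> insert b N then 0 else D n x" "{a..b}" "\<lambda>_. L" ?g,
      OF has_integral_integrable[OF DI'] integrable_const_ivl bnd conv]
  have "(?g has_integral (f b - f a)) {a..b}"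
  proof -
    have "integral {a..b} ?g = f b - f a"
      using LIMSEQ_unique[OF dc(2)] Ilim by (simp only: integral_unique[OF DI'])
    then show ?thesis using dc(1) by (simp add: has_integral_iff)
  qed
  then show ?thesis
    by (rule has_integral_spike[OF neg, rotated]) auto
qed

lemma AE_lebesgue_on_negligibleE:
  fixes S :: "'a::euclidean_space set"
  assumes "AE x in lebesgue_on S. P x" "S \<in> sets lebesgue"
  obtains N where "negligible N" "\<And>x. x \<in> S - N \<Longrightarrow> P x"
proof -
  have "AE x in lebesgue. x \<in> S \<longrightarrow> P x"
    using assms by (simp add: AE_restrict_space_iff)
  then obtain N where "N \<in> null_sets lebesgue" "{x. \<not> (x \<in> S \<longrightarrow> P x)} \<subseteq> N"
    by (auto simp: eventually_ae_filter)
  then show ?thesis by (intro that[of N]) (auto simp: negligible_iff_null_sets)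
qed

lemma AE_lebesgue_onI:
  fixes S :: "'a::euclidean_space set"
  assumes "S \<in> sets lebesgue" "negligible N" "\<And>x. x \<in> S - N \<Longrightarrow> P x"
  shows "AE x in lebesgue_on S. P x"
proof -
  have "AE x in lebesgue. x \<in> S \<longrightarrow> P x"
    by (rule AE_I'[of N]) (use assms in \<open>auto simp: negligible_iff_null_sets\<close>)
  then show ?thesis using assms(1) by (simp add: AE_restrict_space_iff)
qed

text \<open>
  The form in which differential inequalities along Lipschitz curves are integrated below.
\<close>
lemma lipschitz_increment_le_integral:
  fixes f H :: "real \<Rightarrow> real"
  assumes ab: "a \<le> b" and lip: "L-lipschitz_on {a..b} f"
    and der: "AE x in lebesgue_on {a..b}. \<exists>d. (f has_real_derivative d) (at x within {a..b}) \<and> d \<le> H x"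
    and H: "integrable (lebesgue_on {a..b}) H"
  shows "f b - f a \<le> (LINT x|lebesgue_on {a..b}. H x)"
proof -
  obtain N where N: "negligible N"
    "\<And>x. x \<in> {a..b} - N \<Longrightarrow> \<exists>d. (f has_real_derivative d) (at x within {a..b}) \<and> d \<le> H x"
    using AE_lebesgue_on_negligibleE[OF der] by auto
  then obtain h where h: "\<And>x. x \<in> {a..b} - N \<Longrightarrow> (f has_real_derivative h x) (at x within {a..b})"
    "\<And>x. x \<in> {a..b} - N \<Longrightarrow> h x \<le> H x" by metis
  have 1: "(h has_integral (f b - f a)) {a..b}"
    by (rule lipschitz_has_integral_derivative[OF ab lip N(1) h(1)])
  have 2: "((\<lambda>x. if x \<in> N then H x else h x) has_integral (f b - f a)) {a..b}"
    by (rule has_integral_spike[OF N(1) _ 1]) auto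
  have 3: "(H has_integral (LINT x|lebesgue_on {a..b}. H x)) {a..b}"
    by (rule has_integral_integral_lebesgue_on[OF H]) simp
  show ?thesis
    by (rule has_integral_le[OF 2 3]) (use h(2) in auto)
qed

lemma lipschitz_on_inner:
  fixes f g :: "'b::metric_space \<Rightarrow> 'a::real_inner"
  assumes f: "L-lipschitz_on X f" "\<And>x. x \<in> X \<Longrightarrow> norm (f x) \<le> B"
    and g: "M-lipschitz_on X g" "\<And>x. x \<in> X \<Longrightarrow> norm (g x) \<le> C" and BC: "0 \<le> B" "0 \<le> C"
  shows "(L * C + B * M)-lipschitz_on X (\<lambda>x. f x \<bullet> g x)"
proof (rule lipschitz_onI)
  show "0 \<le> L * C + B * M"
    using lipschitz_on_nonneg[OF f(1)] lipschitz_on_nonneg[OF g(1)] BC by simp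
  fix x y assume xy: "x \<in> X" "y \<in> X"
  have "f x \<bullet> g x - f y \<bullet> g y = (f x - f y) \<bullet> g x + f y \<bullet> (g x - g y)"
    by (simp add: inner_diff)
  then have "\<bar>f x \<bullet> g x - f y \<bullet> g y\<bar> \<le> norm (f x - f y) * norm (g x) + norm (f y) * norm (g x - g y)"
    using Cauchy_Schwarz_ineq2[of "f x - f y" "g x"] Cauchy_Schwarz_ineq2[of "f y" "g x - g y"] by linarith
  also have "\<dots> \<le> (L * dist x y) * C + B * (M * dist x y)"
    using lipschitz_onD[OF f(1) xy] lipschitz_onD[OF g(1) xy] f(2) g(2) xy BC
      lipschitz_on_nonneg[OF f(1)] lipschitz_on_nonneg[OF g(1)]
    by (intro add_mono mult_mono) (auto simp: dist_norm)
  finally show "dist (f x \<bullet> g x) (f y \<bullet> g y) \<le> (L * C + B * M) * dist x y"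
    by (simp add: dist_real_def algebra_simps)
qed

lemma lipschitz_on_ivl_inner:
  fixes f g :: "real \<Rightarrow> 'a::real_inner"
  assumes "\<exists>L. L-lipschitz_on {a..b} f" "\<exists>M. M-lipschitz_on {a..b} g"
  shows "\<exists>L. L-lipschitz_on {a..b} (\<lambda>x. f x \<bullet> g x)"
proof -
  have bnd: "\<exists>B\<ge>0. \<forall>x\<in>{a..b}. norm (F x) \<le> B" if "\<exists>L. L-lipschitz_on {a..b} F" for F :: "real \<Rightarrow> 'a"
  proof -
    have "continuous_on {a..b} F" using that lipschitz_on_continuous_on by blast
    then have "bounded (F ` {a..b})" by (intro compact_imp_bounded compact_continuous_image) auto
    then obtain B where "B > 0" "\<forall>x\<in>F ` {a..b}. norm x \<le> B" by (auto simp: bounded_pos)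
    then show ?thesis by (intro exI[of _ B]) auto
  qed
  obtain L M B C where "L-lipschitz_on {a..b} f" "M-lipschitz_on {a..b} g" "B \<ge> 0" "C \<ge> 0"
    "\<forall>x\<in>{a..b}. norm (f x) \<le> B" "\<forall>x\<in>{a..b}. norm (g x) \<le> C" using assms bnd[OF assms(1)] bnd[OF assms(2)] by metis
  then show ?thesis using lipschitz_on_inner[of L "{a..b}" f B M g C] by blast
qed

lemma C1_lipschitz_on_ivl:
  fixes f :: "real \<Rightarrow> 'a::euclidean_space"
  assumes der: "\<And>x. x \<in> {a..b} \<Longrightarrow> (f has_vector_derivative f' x) (at x within {a..b})"
    and cont: "continuous_on {a..b} f'"
  shows "\<exists>L. L-lipschitz_on {a..b} f"
proof -
  have "bounded (f' ` {a..b})" using cont by (intro compact_imp_bounded compact_continuous_image) auto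
  then obtain B where B: "B > 0" "\<forall>x\<in>f' ` {a..b}. norm x \<le> B" by (auto simp: bounded_pos)
  have "B-lipschitz_on {a..b} f"
  proof (rule bounded_derivative_imp_lipschitz)
    show "(f has_derivative (\<lambda>h. h *\<^sub>R f' x)) (at x within {a..b})" if "x \<in> {a..b}" for x
      using der[OF that] by (simp add: has_vector_derivative_def)
    show "onorm (\<lambda>h. h *\<^sub>R f' x) \<le> B" if "x \<in> {a..b}" for x
      using B that by (simp add: onorm_scaleR_left bounded_linear_ident onorm_id)
  qed (use B in auto)
  then show ?thesis ..
qed

lemma linear_lipschitz_on:
  fixes A :: "'a::euclidean_space \<Rightarrow> 'b::real_normed_vector"
  assumes "linear A" "\<exists>L. L-lipschitz_on X f"
  shows "\<exists>L. L-lipschitz_on X (\<lambda>x. A (f x))"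
proof -
  obtain B where "B-lipschitz_on UNIV A"
    using bounded_linear.lipschitz_boundE[OF linear_conv_bounded_linear[THEN iffD1, OF assms(1)]] by metis
  moreover obtain L where "L-lipschitz_on X f" using assms by blast
  ultimately show ?thesis
    by (metis lipschitz_on_compose2 lipschitz_on_subset subset_UNIV)
qed

section \<open>The skew operators of the group\<close>

lemma inner_outer_left: "outer a b \<bullet> x = a \<bullet> (x *v b)"
  by (simp add: inner_vec_def outer_def matrix_vector_mult_def sum_distrib_left mult_ac)

lemma outer_vector_mult: "c v* outer a b = (a \<bullet> c) *\<^sub>R b"
  by (simp add: vec_eq_iff outer_def vector_matrix_mult_def inner_vec_def
      sum_distrib_left sum_distrib_right mult_ac)

lemma outer_mult: "outer a b *v c = (b \<bullet> c) *\<^sub>R a"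
  by (simp add: vec_eq_iff outer_def matrix_vector_mult_def inner_vec_def
      sum_distrib_left sum_distrib_right mult_ac)

lemma outer_add_right: "outer a (b + c) = outer a b + outer a c"
  and outer_scaleR_right: "outer a (r *\<^sub>R b) = r *\<^sub>R outer a b"
  and outer_scaleR_left: "outer (r *\<^sub>R a) b = r *\<^sub>R outer a b"
  and outer_minus_right: "outer a (- b) = - outer a b"
  by (simp_all add: vec_eq_iff outer_def algebra_simps)

lemma outer_zero_right: "outer a 0 = 0"
  by (simp add: vec_eq_iff outer_def)

lemma norm_outer: "norm (outer a b) = norm a * norm b"
proof -
  have "(norm (outer a b))\<^sup>2 = (norm a * norm b)\<^sup>2"
    by (simp add: power2_norm_eq_inner inner_outer_left outer_mult power_mult_distrib)
  then show ?thesis by (metis abs_ge_zero norm_ge_zero power2_eq_imp_eq mult_nonneg_nonneg)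
qed

lemma vector_matrix_scaleR_right: "c v* (r *\<^sub>R x) = r *\<^sub>R (c v* (x :: real^'n^'m))"
  and vector_matrix_minus_right: "c v* (- x) = - (c v* x)"
  by (simp_all add: vec_eq_iff vector_matrix_mult_def sum_distrib_left sum_negf mult_ac)

lemma Aop_eq: "Aop \<tau> z = (outer \<tau> (snd z), - (\<tau> v* fst z))"
  by (simp add: Aop_def)

lemma linear_Aop: "linear (Aop \<tau>)"
  by (rule linearI)
     (simp_all add: Aop_eq outer_add_right outer_scaleR_right vector_matrix_scaleR_right
       vector_matrix_left_distrib vector_matrix_mult_add_rdistrib)

lemmas Aop_simps = linear_add[OF linear_Aop] linear_diff[OF linear_Aop] linear_scale[OF linear_Aop]
  linear_neg[OF linear_Aop] linear_0[OF linear_Aop]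

lemma bounded_linear_Aop: "bounded_linear (Aop \<tau>)"
  using linear_Aop linear_conv_bounded_linear by blast

lemma bounded_bilinear_Qform: "bounded_bilinear Qform"
proof -
  have "bilinear Qform"
    unfolding bilinear_def
    by (intro conjI allI linearI)
       (simp_all add: Qform_def algebra_simps matrix_vector_mult_add_rdistrib
        scaleR_matrix_vector_assoc)
  then show ?thesis by (rule bilinear_conv_bounded_bilinear[THEN iffD1])
qed

lemma Qform_antisym: "Qform z w = - Qform w z"
  by (simp add: Qform_def flip: scaleR_minus_right)

lemma Qform_self: "Qform z z = 0"
  by (simp add: Qform_def)

text \<open>
  This identity links the vertical component of a horizontal curve to the operator that drives
  the extremals; the skewness of \<^const>\<open>Aop\<close> is the antisymmetry of \<^const>\<open>Qform\<close>.
\<close>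
lemma inner_Qform: "\<tau> \<bullet> Qform z w = 1/2 * (z \<bullet> Aop \<tau> w)"
  by (simp add: Qform_def Aop_eq inner_prod_def inner_outer_left dot_lmul_matrix
      inner_commute[of _ "outer _ _"] inner_commute[of _ "_ v* _"] inner_diff_right)

lemma Aop_skew: "Aop \<tau> z \<bullet> w = - (z \<bullet> Aop \<tau> w)"
proof -
  have "z \<bullet> Aop \<tau> w = 2 * (\<tau> \<bullet> Qform z w)" by (simp add: inner_Qform)
  also have "\<dots> = - (2 * (\<tau> \<bullet> Qform w z))" by (subst Qform_antisym) simp
  also have "\<dots> = - (w \<bullet> Aop \<tau> z)" by (simp add: inner_Qform)
  finally show ?thesis by (simp add: inner_commute)
qed

lemma inner_Aop_self: "z \<bullet> Aop \<tau> z = 0"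
  using Aop_skew[of \<tau> z z] by (simp add: inner_commute)

text \<open>
  Thus \<open>Aop \<tau>\<close> is \<open>norm \<tau>\<close> times a complex structure on its range and vanishes on the orthogonal
  complement of its range.
\<close>
lemma Aop_cube: "Aop \<tau> (Aop \<tau> (Aop \<tau> z)) = - ((norm \<tau>)\<^sup>2 *\<^sub>R Aop \<tau> z)"
  by (simp add: Aop_eq outer_vector_mult outer_minus_right outer_scaleR_right
      vector_matrix_minus_right power2_norm_eq_inner)

text \<open>
  The hypothesis on \<open>\<eta>\<close> and \<open>P\<^sub>\<tau> \<xi>\<close> in the theorem says that the initial velocity is
  not fixed by the rotation, that is, that the extremal is not a straight line.
\<close>
lemma Aop_eq_0_iff:
  assumes "\<tau> \<noteq> 0"
  shows "Aop \<tau> (\<xi>, \<eta>) = 0 \<longleftrightarrow> \<not> norm \<eta> + norm (Pproj \<tau> ** \<xi>) > 0"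
proof -
  have "outer \<tau> \<tau> ** \<xi> = outer \<tau> (\<tau> v* \<xi>)"
    by (simp add: vec_eq_iff outer_def matrix_matrix_mult_def vector_matrix_mult_def
        sum_distrib_left mult_ac)
  then have "Pproj \<tau> ** \<xi> = (1 / (norm \<tau>)\<^sup>2) *\<^sub>R outer \<tau> (\<tau> v* \<xi>)"
    by (simp add: Pproj_def divide_inverse flip: scalar_matrix_assoc)
  then have "norm (Pproj \<tau> ** \<xi>) = norm (\<tau> v* \<xi>) / norm \<tau>"
    using assms by (simp add: norm_outer power2_eq_square)
  moreover have "outer \<tau> \<eta> = 0 \<longleftrightarrow> \<eta> = 0"
    using assms norm_outer[of \<tau> \<eta>] by auto
  ultimately show ?thesis
    using assms by (simp add: Aop_eq zero_prod_def not_less antisym_conv add_nonneg_eq_0_iff)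
qed

lemma Aop_frame:
  fixes \<tau> :: "real^'q::finite" and u :: "real^'p::finite"
  assumes "\<tau> \<noteq> 0"
  shows "Aop \<tau> (outer (\<tau> /\<^sub>R norm \<tau>) u, 0) = - (norm \<tau> *\<^sub>R (0, u))"
    and "Aop \<tau> (0, u) = norm \<tau> *\<^sub>R (outer (\<tau> /\<^sub>R norm \<tau>) u, 0)"
  using assms
  by (simp_all add: Aop_eq outer_zero_right outer_scaleR_left vector_matrix_scaleR_right
      outer_vector_mult power2_norm_eq_inner[symmetric] power2_eq_square)

section \<open>Extremals as horizontal curves\<close>

text \<open>
  Since \<open>A\<^sup>3 = - \<omega>\<^sup>2 A\<close>, the powers of \<open>- s A\<close> only involve \<open>v\<close>, \<open>A v\<close> and \<open>A\<^sup>2 v\<close>, and the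
  coefficients are the Taylor coefficients of cosine and sine. The case \<open>n = 0\<close> carries the
  component \<open>v + A\<^sup>2 v / \<omega>\<^sup>2\<close> in the kernel of \<open>A\<close>.
\<close>
lemma exp_op_Aop_funpow:
  fixes \<tau> :: "real^'q::finite" and v :: "('q, 'p::finite) layer1"
  assumes "\<tau> \<noteq> 0"
  defines "\<omega> \<equiv> norm \<tau>"
  shows "((\<lambda>z. - s *\<^sub>R Aop \<tau> z) ^^ n) v /\<^sub>R fact n =
    (if n = 0 then v + (1 / \<omega>\<^sup>2) *\<^sub>R Aop \<tau> (Aop \<tau> v) else 0)
    - (cos_coeff n * (\<omega> * s) ^ n) *\<^sub>R ((1 / \<omega>\<^sup>2) *\<^sub>R Aop \<tau> (Aop \<tau> v))
    - (sin_coeff n * (\<omega> * s) ^ n) *\<^sub>R ((1 / \<omega>) *\<^sub>R Aop \<tau> v)"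
proof (induction n)
  case 0
  then show ?case by simp
next
  case (Suc n)
  have w: "\<omega> \<noteq> 0" using assms by simp
  let ?B = "\<lambda>z. - s *\<^sub>R Aop \<tau> z"
  have "(?B ^^ Suc n) v /\<^sub>R fact (Suc n) = (1 / real (Suc n)) *\<^sub>R ?B ((?B ^^ n) v /\<^sub>R fact n)"
    by (simp add: Aop_simps divide_inverse mult_ac del: of_nat_Suc)
  also have "?B ((?B ^^ n) v /\<^sub>R fact n) =
     (sin_coeff n * (\<omega> * s) ^ n * (s / \<omega>)) *\<^sub>R Aop \<tau> (Aop \<tau> v) - (s * cos_coeff n * (\<omega> * s) ^ n) *\<^sub>R Aop \<tau> v"
    using w unfolding Suc.IH by (simp add: Aop_simps Aop_cube \<omega>_def[symmetric] algebra_simps)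
  also have "(1 / real (Suc n)) *\<^sub>R \<dots> =
      - (cos_coeff (Suc n) * (\<omega> * s) ^ Suc n) *\<^sub>R ((1 / \<omega>\<^sup>2) *\<^sub>R Aop \<tau> (Aop \<tau> v))
    - (sin_coeff (Suc n) * (\<omega> * s) ^ Suc n) *\<^sub>R ((1 / \<omega>) *\<^sub>R Aop \<tau> v)"
    using w by (simp add: cos_coeff_Suc sin_coeff_Suc scaleR_diff_right power2_eq_square divide_simps
        mult_ac del: of_nat_Suc)
  finally show ?case by simp
qed

lemma extremal_control_eq:
  assumes "\<tau> \<noteq> 0"
  shows "extremal_control \<xi> \<eta> \<tau> s = (\<xi>, \<eta>)
      + ((1 - cos (norm \<tau> * s)) / (norm \<tau>)\<^sup>2) *\<^sub>R Aop \<tau> (Aop \<tau> (\<xi>, \<eta>))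
      - (sin (norm \<tau> * s) / norm \<tau>) *\<^sub>R Aop \<tau> (\<xi>, \<eta>)"
proof -
  let ?w = "norm \<tau>" and ?v = "(\<xi>, \<eta>)"
  have c: "(\<lambda>n. cos_coeff n * (?w * s) ^ n) sums cos (?w * s)"
    and s: "(\<lambda>n. sin_coeff n * (?w * s) ^ n) sums sin (?w * s)"
    using cos_converges[of "?w * s"] sin_converges[of "?w * s"] by simp_all
  have 0: "(\<lambda>n. if n = 0 then ?v + (1 / ?w\<^sup>2) *\<^sub>R Aop \<tau> (Aop \<tau> ?v) else 0) sums
      (?v + (1 / ?w\<^sup>2) *\<^sub>R Aop \<tau> (Aop \<tau> ?v))"
    by (rule sums_single)
  have "(\<lambda>n. ((\<lambda>z. - s *\<^sub>R Aop \<tau> z) ^^ n) ?v /\<^sub>R fact n) sums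
     (?v + (1 / ?w\<^sup>2) *\<^sub>R Aop \<tau> (Aop \<tau> ?v) - cos (?w * s) *\<^sub>R ((1 / ?w\<^sup>2) *\<^sub>R Aop \<tau> (Aop \<tau> ?v))
      - sin (?w * s) *\<^sub>R ((1 / ?w) *\<^sub>R Aop \<tau> ?v))"
    unfolding exp_op_Aop_funpow[OF assms]
    by (intro sums_diff sums_scaleR_left 0 c s)
  then show ?thesis
    unfolding extremal_control_def exp_op_def
    by (simp add: sums_iff diff_divide_distrib scaleR_diff_left)
qed

lemma extremal_control_degenerate:
  assumes "Aop \<tau> (\<xi>, \<eta>) = 0"
  shows "extremal_control \<xi> \<eta> \<tau> s = (\<xi>, \<eta>)"
proof -
  have "((\<lambda>z. - s *\<^sub>R Aop \<tau> z) ^^ n) (\<xi>, \<eta>) = (if n = 0 then (\<xi>, \<eta>) else 0)" for n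
    by (induction n) (auto simp: assms Aop_simps)
  then have "(\<lambda>n. ((\<lambda>z. - s *\<^sub>R Aop \<tau> z) ^^ n) (\<xi>, \<eta>) /\<^sub>R fact n) = (\<lambda>n. if n = 0 then (\<xi>, \<eta>) else 0)"
    by (auto simp: fun_eq_iff)
  then show ?thesis
    unfolding extremal_control_def exp_op_def
    using sums_single[of 0 "\<lambda>_. (\<xi>, \<eta>)"] by (simp add: sums_iff)
qed

lemma Aop_zero: "Aop 0 z = 0"
  by (simp add: Aop_eq outer_def zero_prod_def vec_eq_iff vector_matrix_mult_def)

lemma extremal_control_derivative:
  "((extremal_control \<xi> \<eta> \<tau>) has_vector_derivative - Aop \<tau> (extremal_control \<xi> \<eta> \<tau> s)) (at s within X)"
proof (cases "Aop \<tau> (\<xi>, \<eta>) = 0")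
  case True
  then have "extremal_control \<xi> \<eta> \<tau> = (\<lambda>_. (\<xi>, \<eta>))"
    by (intro ext extremal_control_degenerate)
  then show ?thesis by (simp add: True)
next
  case False
  then have t: "\<tau> \<noteq> 0" by (auto simp: Aop_zero)
  show ?thesis
  proof (rule has_vector_derivative_eq_rhs)
    show "(extremal_control \<xi> \<eta> \<tau> has_vector_derivative
        ((sin (norm \<tau> * s) / norm \<tau>) *\<^sub>R Aop \<tau> (Aop \<tau> (\<xi>, \<eta>)) - cos (norm \<tau> * s) *\<^sub>R Aop \<tau> (\<xi>, \<eta>)))
        (at s within X)"
      unfolding extremal_control_eq[OF t, abs_def]
      using t by (auto intro!: derivative_eq_intros
        simp: power2_eq_square has_vector_derivative_def algebra_simps)
    show "(sin (norm \<tau> * s) / norm \<tau>) *\<^sub>R Aop \<tau> (Aop \<tau> (\<xi>, \<eta>)) - cos (norm \<tau> * s) *\<^sub>R Aop \<tau> (\<xi>, \<eta>)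
        = - Aop \<tau> (extremal_control \<xi> \<eta> \<tau> s)"
      using t by (simp add: extremal_control_eq Aop_simps Aop_cube scaleR_diff_left)
  qed
qed

lemma extremal_control_0: "extremal_control \<xi> \<eta> \<tau> 0 = (\<xi>, \<eta>)"
  by (cases "\<tau> = 0") (simp_all add: extremal_control_eq extremal_control_degenerate Aop_zero)

lemma continuous_on_extremal_control: "continuous_on X (extremal_control \<xi> \<eta> \<tau>)"
  by (rule continuous_on_vector_derivative[OF extremal_control_derivative])

lemma norm_extremal_control: "norm (extremal_control \<xi> \<eta> \<tau> s) = norm (\<xi>, \<eta>)"
proof -
  let ?w = "extremal_control \<xi> \<eta> \<tau>"
  have "((\<lambda>s. ?w s \<bullet> ?w s) has_real_derivative 0) (at s)" for s
  proof -
    have "((\<lambda>s. ?w s \<bullet> ?w s) has_vector_derivative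
        (?w s \<bullet> - Aop \<tau> (?w s) + - Aop \<tau> (?w s) \<bullet> ?w s)) (at s)"
      by (intro bounded_bilinear.has_vector_derivative[OF bounded_bilinear_inner]
          extremal_control_derivative)
    then show ?thesis
      by (simp add: has_real_derivative_iff_has_vector_derivative inner_Aop_self Aop_skew)
  qed
  then have "?w s \<bullet> ?w s = ?w 0 \<bullet> ?w 0"
    by (rule DERIV_isconst_all[rule_format]) 
  then show ?thesis by (simp add: extremal_control_0 norm_eq_sqrt_inner)
qed

lemma extremal_layer1_derivative:
  assumes "s \<in> {0..T}"
  shows "((extremal_layer1 \<xi> \<eta> \<tau>) has_vector_derivative extremal_control \<xi> \<eta> \<tau> s) (at s within {0..T})"
  using interval_integral_FTC2[of 0 0 T "extremal_control \<xi> \<eta> \<tau>" s] assms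
  by (simp add: extremal_layer1_def[abs_def] continuous_on_extremal_control flip: zero_ereal_def)

lemma extremal_layer1_0: "extremal_layer1 \<xi> \<eta> \<tau> 0 = 0"
  by (simp add: extremal_layer1_def flip: zero_ereal_def)

lemma extremal_0: "extremal \<xi> \<eta> \<tau> 0 = 0"
  by (simp add: extremal_def extremal_layer1_0 zero_prod_def flip: zero_ereal_def)

lemma continuous_on_extremal_layer1: "continuous_on {0..T} (extremal_layer1 \<xi> \<eta> \<tau>)"
  by (rule continuous_on_vector_derivative[OF extremal_layer1_derivative])

lemma extremal_layer2_derivative:
  assumes "s \<in> {0..T}"
  shows "((\<lambda>s. snd (extremal \<xi> \<eta> \<tau> s)) has_vector_derivative
      Qform (extremal_layer1 \<xi> \<eta> \<tau> s) (extremal_control \<xi> \<eta> \<tau> s)) (at s within {0..T})"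
proof -
  have "continuous_on {0..T} (\<lambda>s. Qform (extremal_layer1 \<xi> \<eta> \<tau> s) (extremal_control \<xi> \<eta> \<tau> s))"
    by (intro bounded_bilinear.continuous_on[OF bounded_bilinear_Qform]
        continuous_on_extremal_layer1 continuous_on_extremal_control)
  then show ?thesis
    using interval_integral_FTC2[of 0 0 T _ s] assms
    by (simp add: extremal_def[abs_def] flip: zero_ereal_def)
qed

lemma fst_extremal: "fst (extremal \<xi> \<eta> \<tau> s) = extremal_layer1 \<xi> \<eta> \<tau> s"
  by (simp add: extremal_def)

text \<open>
  A first integral of the equation \<open>w' = - A w\<close> satisfied by the control \<open>w = z'\<close>.
\<close>
lemma extremal_control_plus_Aop_layer1:
  assumes "s \<ge> 0"
  shows "extremal_control \<xi> \<eta> \<tau> s + Aop \<tau> (extremal_layer1 \<xi> \<eta> \<tau> s) = (\<xi>, \<eta>)"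
proof -
  let ?w = "extremal_control \<xi> \<eta> \<tau>" and ?z = "extremal_layer1 \<xi> \<eta> \<tau>"
  obtain c where c: "\<And>r. r \<in> {0..s} \<Longrightarrow> ?w r + Aop \<tau> (?z r) = c"
  proof (rule has_vector_derivative_zero_constant)
    fix r assume r: "r \<in> {0..s}"
    have "((\<lambda>r. ?w r + Aop \<tau> (?z r)) has_vector_derivative (- Aop \<tau> (?w r) + Aop \<tau> (?w r))) (at r within {0..s})"
      by (intro has_vector_derivative_add extremal_control_derivative
          bounded_linear.has_vector_derivative[OF bounded_linear_Aop] extremal_layer1_derivative r)
    then show "((\<lambda>r. ?w r + Aop \<tau> (?z r)) has_vector_derivative 0) (at r within {0..s})" by simp
  qed auto
  show ?thesis
    using c[of 0] c[of s] assms by (simp add: extremal_control_0 extremal_layer1_0 Aop_simps)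
qed

lemma horizontalI_C1:
  fixes \<gamma> :: "real \<Rightarrow> ('q::finite, 'p::finite) carnot"
  assumes der: "\<And>s. s \<in> {0..T} \<Longrightarrow> (\<gamma> has_vector_derivative (w s, Qform (fst (\<gamma> s)) (w s))) (at s within {0..T})"
    and w: "continuous_on {0..T} w"
  shows "horizontal T \<gamma> w"
  unfolding horizontal_def
proof (intro conjI)
  have "continuous_on {0..T} \<gamma>"
    using der by (rule continuous_on_vector_derivative)
  then have "continuous_on {0..T} (\<lambda>s. (w s, Qform (fst (\<gamma> s)) (w s)))"
    by (intro continuous_intros w bounded_bilinear.continuous_on[OF bounded_bilinear_Qform])
  with der show "\<exists>L. L-lipschitz_on {0..T} \<gamma>"
    by (rule C1_lipschitz_on_ivl)
  show "w \<in> borel_measurable (lebesgue_on {0..T})"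
    by (rule continuous_imp_measurable_on_sets_lebesgue[OF w]) simp
  have "bounded (w ` {0..T})" using w by (intro compact_imp_bounded compact_continuous_image) auto
  then obtain B where "\<forall>x\<in>w ` {0..T}. norm x \<le> B" by (auto simp: bounded_iff)
  then show "\<exists>B. AE s in lebesgue_on {0..T}. norm (w s) \<le> B"
    by (intro exI[of _ B] AE_I2) (auto simp: space_restrict_space)
  show "AE s in lebesgue_on {0..T}.
       (\<gamma> has_vector_derivative (w s, Qform (fst (\<gamma> s)) (w s))) (at s within {0..T})"
    using der by (intro AE_I2) (auto simp: space_restrict_space)
qed

lemma horizontal_extremal: "horizontal T (extremal \<xi> \<eta> \<tau>) (extremal_control \<xi> \<eta> \<tau>)"
proof (rule horizontalI_C1)
  fix s assume s: "s \<in> {0..T}"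
  have "((\<lambda>s. (extremal_layer1 \<xi> \<eta> \<tau> s, snd (extremal \<xi> \<eta> \<tau> s))) has_vector_derivative 
     (extremal_control \<xi> \<eta> \<tau> s, Qform (extremal_layer1 \<xi> \<eta> \<tau> s) (extremal_control \<xi> \<eta> \<tau> s))) (at s within {0..T})"
    by (intro has_vector_derivative_Pair extremal_layer1_derivative extremal_layer2_derivative s)
  moreover have "(\<lambda>s. (extremal_layer1 \<xi> \<eta> \<tau> s, snd (extremal \<xi> \<eta> \<tau> s))) = extremal \<xi> \<eta> \<tau>"
    by (simp add: extremal_def fun_eq_iff)
  ultimately show "(extremal \<xi> \<eta> \<tau> has_vector_derivative
      (extremal_control \<xi> \<eta> \<tau> s, Qform (fst (extremal \<xi> \<eta> \<tau> s)) (extremal_control \<xi> \<eta> \<tau> s)))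
      (at s within {0..T})" by (simp add: fst_extremal)
qed (rule continuous_on_extremal_control)

lemma horizontal_length_eq_norm: "horizontal_length T w = (LINT s|lebesgue_on {0..T}. norm (w s))"
  by (simp add: horizontal_length_def norm_prod_def)

lemma horizontal_length_extremal:
  assumes "T \<ge> 0"
  shows "horizontal_length T (extremal_control \<xi> \<eta> \<tau>) = norm (\<xi>, \<eta>) * T"
  unfolding horizontal_length_eq_norm norm_extremal_control
  using assms by (simp add: measure_restrict_space)

section \<open>Minimality up to one period\<close>

text \<open>
  The pointwise identity behind minimality. In \<open>weighted_energy_lower_bound\<close>, \<open>\<delta>\<close> is the deviation of a
  competitor from the extremal and \<open>d\<close> its derivative, \<open>wb\<close> and \<open>zb\<close> are the control and
  the horizontal part of the extremal, and \<open>\<rho>\<close> is the speed of a time change.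
  Up to the last square, the left side is then the derivative of the function \<open>G\<close> defined in that proof,
  because \<open>C\<close> will satisfy the Riccati equation \<open>C' = - \<kappa>\<^sup>2 - C\<^sup>2\<close>. The right side is the
  excess of the energy density of the competitor over that of the extremal, plus an error that
  disappears as \<open>\<kappa>\<close> tends to \<open>\<omega> / 2\<close>.
\<close>
lemma completed_square:
  fixes \<tau> :: "real^'q::finite" and \<delta> d wb zb :: "('q, 'p::finite) layer1" and \<rho> C \<kappa> :: real
  assumes "\<tau> \<noteq> 0" "\<rho> > 0"
  defines "A \<equiv> Aop \<tau>" and "\<omega> \<equiv> norm \<tau>"
  shows "\<rho> * (- \<kappa>\<^sup>2 - C\<^sup>2) * (norm (A \<delta>))\<^sup>2 / \<omega>\<^sup>2 + 2 * C * (A \<delta> \<bullet> A d) / \<omega>\<^sup>2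
      + (\<delta> + zb) \<bullet> A (d + \<rho> *\<^sub>R wb) - \<rho> * (zb \<bullet> A wb)
      + d \<bullet> (2 *\<^sub>R wb + A zb) - \<rho> * (\<delta> \<bullet> A wb)
      + (norm (d + (\<rho> / 2) *\<^sub>R A \<delta> + (\<rho> * C / \<omega>\<^sup>2) *\<^sub>R A (A \<delta>)))\<^sup>2 / \<rho>
    = (norm (d + \<rho> *\<^sub>R wb))\<^sup>2 / \<rho> - \<rho> * (norm wb)\<^sup>2 + \<rho> * ((\<omega> / 2)\<^sup>2 - \<kappa>\<^sup>2) * (norm (A \<delta>))\<^sup>2 / \<omega>\<^sup>2"
proof -
  have w: "\<omega> \<noteq> 0" using assms by simp
  have sk: "A x \<bullet> y = - (x \<bullet> A y)" for x y unfolding A_def by (rule Aop_skew)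
  have 1: "d \<bullet> A \<delta> = - (\<delta> \<bullet> A d)" using sk[of \<delta> d] by (simp add: inner_commute)
  have 2: "A \<delta> \<bullet> A (A \<delta>) = 0" unfolding A_def by (rule inner_Aop_self)
  have 3: "A (A \<delta>) \<bullet> A (A \<delta>) = \<omega>\<^sup>2 * (A \<delta> \<bullet> A \<delta>)"
    using sk[of "A \<delta>" "A (A \<delta>)"] Aop_cube[of \<tau> \<delta>] by (simp add: A_def \<omega>_def)
  have 4: "d \<bullet> A (A \<delta>) = - (A \<delta> \<bullet> A d)" using sk[of d "A \<delta>"] by (simp add: inner_commute)
  have 5: "zb \<bullet> A d = - (d \<bullet> A zb)" using sk[of zb d] by (simp add: inner_commute)
  have lin: "A (x + y) = A x + A y" "A (r *\<^sub>R x) = r *\<^sub>R A x" for x y r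
    by (simp_all add: A_def Aop_simps)
  have e1: "(norm (d + (\<rho> / 2) *\<^sub>R A \<delta> + (\<rho> * C / \<omega>\<^sup>2) *\<^sub>R A (A \<delta>)))\<^sup>2 =
     d \<bullet> d + (\<rho> / 2)\<^sup>2 * (A \<delta> \<bullet> A \<delta>) + (\<rho> * C)\<^sup>2 / \<omega>\<^sup>2 * (A \<delta> \<bullet> A \<delta>) - \<rho> * (\<delta> \<bullet> A d)
      - 2 * (\<rho> * C / \<omega>\<^sup>2) * (A \<delta> \<bullet> A d)"
    using w unfolding power2_norm_eq_inner
    by (simp add: inner_add_left inner_add_right 1 2 3 4 inner_commute[of "A \<delta>" d] inner_commute[of "A (A \<delta>)" d] inner_commute[of "A (A \<delta>)" "A \<delta>"])
       (simp add: power2_eq_square field_simps)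
  have e2: "(norm (d + \<rho> *\<^sub>R wb))\<^sup>2 = d \<bullet> d + 2 * \<rho> * (d \<bullet> wb) + \<rho>\<^sup>2 * (norm wb)\<^sup>2"
    unfolding power2_norm_eq_inner
    by (simp add: inner_add_left inner_add_right inner_commute[of wb d] power2_eq_square algebra_simps)
  have e3: "(\<delta> + zb) \<bullet> A (d + \<rho> *\<^sub>R wb) = \<delta> \<bullet> A d + \<rho> * (\<delta> \<bullet> A wb) - d \<bullet> A zb + \<rho> * (zb \<bullet> A wb)"
    by (simp add: lin inner_add_left inner_add_right 5 algebra_simps)
  show ?thesis
    unfolding e1 e2 e3 using w assms(2)
    by (simp add: power2_norm_eq_inner inner_add_right)
       (simp add: power2_eq_square field_simps)
qed

text \<open>
  The Riccati solution \<open>\<kappa> cot (\<kappa> u)\<close> is singular at \<open>u = 0\<close>. A frequency \<open>\<kappa>\<close>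
  slightly below \<open>pi / T\<close> leaves room for a phase shift that removes the singularities from the
  closed interval; with \<open>T = 2 pi / \<omega>\<close>, the critical frequency \<open>pi / T\<close> is \<open>\<omega> / 2\<close>.
\<close>
lemma shifted_cot:
  fixes \<kappa> T u :: real
  assumes "0 < \<kappa>" "\<kappa> * T < pi" "u \<in> {0..T}"
  defines "C \<equiv> \<lambda>u. \<kappa> * cot (\<kappa> * u + (pi - \<kappa> * T) / 2)"
  shows "(C has_real_derivative (- \<kappa>\<^sup>2 - (C u)\<^sup>2)) (at u)"
proof -
  let ?v = "\<kappa> * u + (pi - \<kappa> * T) / 2"
  have "0 \<le> \<kappa> * u" "\<kappa> * u \<le> \<kappa> * T" using assms by (auto intro: mult_left_mono)
  then have "0 < ?v" "?v < pi" using assms(2) by (auto simp: field_simps)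
  then have s: "sin ?v \<noteq> 0" using sin_gt_zero[of ?v] by simp
  have "(C has_real_derivative (\<kappa> * (- inverse ((sin ?v)\<^sup>2) * \<kappa>))) (at u)"
    unfolding C_def
    by (rule DERIV_cmult, rule DERIV_chain2[where g = "\<lambda>u. \<kappa> * u + (pi - \<kappa> * T) / 2", OF DERIV_cot[OF s]])
       (auto intro!: derivative_eq_intros)
  moreover have "inverse ((sin ?v)\<^sup>2) = 1 + (cot ?v)\<^sup>2"
    using s by (simp add: cot_def divide_simps)
  ultimately show ?thesis
    by (simp add: C_def power2_eq_square algebra_simps)
qed

lemma fst_derivative:
  assumes "(\<gamma> has_vector_derivative (a, b)) F"
  shows "((\<lambda>s. fst (\<gamma> s)) has_vector_derivative a) F"
  using bounded_linear.has_vector_derivative[OF bounded_linear_fst assms] by simp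

lemma snd_derivative:
  assumes "(\<gamma> has_vector_derivative (a, b)) F"
  shows "((\<lambda>s. snd (\<gamma> s)) has_vector_derivative b) F"
  using bounded_linear.has_vector_derivative[OF bounded_linear_snd assms] by simp

lemma integrable_lebesgue_on_bounded:
  fixes f :: "real \<Rightarrow> real"
  assumes "f \<in> borel_measurable (lebesgue_on {a..b})" "AE s in lebesgue_on {a..b}. norm (f s) \<le> B"
  shows "integrable (lebesgue_on {a..b}) f"
proof -
  interpret finite_measure "lebesgue_on {a..b}" by (rule finite_measure_lebesgue_on) simp
  show ?thesis using assms by (intro integrable_const_bound) auto
qed

text \<open>
  The weight \<open>\<rho>\<close> is the speed of the time change \<open>\<theta>\<close> from \<open>{0..S}\<close> onto the period \<open>{0..T}\<close>, and the integral
  on the right is the energy of the competitor reparametrized by \<open>\<theta>\<close>. Writing the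
  competitor in its own parameter and the extremal as a function of \<open>\<theta>\<close> avoids composing the merely
  Lipschitz competitor with an inverse function.

  The lemma is the second variation argument made global: with the covector \<open>\<tau>\<close> as Lagrange
  multiplier the constrained problem becomes quadratic, and the quadratic form of the deviation
  is nonnegative by an inequality of Wirtinger type for one period.
\<close>
lemma weighted_energy_lower_bound:
  fixes \<gamma> :: "real \<Rightarrow> ('q::finite, 'p::finite) carnot"
  assumes \<tau>: "\<tau> \<noteq> 0" and S: "0 < S" and hor: "horizontal S \<gamma> w"
    and \<gamma>0: "\<gamma> 0 = 0" and \<gamma>S: "\<gamma> S = extremal \<xi> \<eta> \<tau> T" and T: "T = 2 * pi / norm \<tau>"
    and \<rho>c: "continuous_on {0..S} \<rho>" and \<rho>0: "\<And>s. s \<in> {0..S} \<Longrightarrow> \<rho> s > 0"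
    and \<theta>: "\<And>s. s \<in> {0..S} \<Longrightarrow> (\<theta> has_real_derivative \<rho> s) (at s within {0..S})"
    and \<theta>0: "\<theta> 0 = 0" and \<theta>S: "\<theta> S = T"
  shows "(norm (\<xi>, \<eta>))\<^sup>2 * T \<le> (LINT s|lebesgue_on {0..S}. (norm (w s))\<^sup>2 / \<rho> s)"
proof -
  define A where A: "A = (Aop \<tau> :: ('q, 'p) layer1 \<Rightarrow> ('q, 'p) layer1)"
  define \<omega> where "\<omega> = norm \<tau>"
  define zb where "zb = extremal_layer1 \<xi> \<eta> \<tau>"
  define wb where "wb = extremal_control \<xi> \<eta> \<tau>"
  define tb where "tb s = snd (extremal \<xi> \<eta> \<tau> s)" for s
  define c where "c = norm (\<xi>, \<eta>)"
  define \<delta> where "\<delta> s = fst (\<gamma> s) - zb (\<theta> s)" for s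
  let ?I = "{0..S}" and ?M = "lebesgue_on {0..S}"
  have \<omega>: "\<omega> > 0" using \<tau> by (simp add: \<omega>_def)
  have Tpos: "T > 0" using T \<omega> by (simp add: \<omega>_def)
  have \<theta>T: "\<theta> s \<in> {0..T}" if "s \<in> ?I" for s
  proof -
    have mono: "\<theta> a \<le> \<theta> b" if "0 \<le> a" "a \<le> b" "b \<le> S" for a b
    proof -
      have "(\<rho> has_integral \<theta> b - \<theta> a) {a..b}"
        using \<theta> that
        by (intro fundamental_theorem_of_calculus)
           (auto simp: has_real_derivative_iff_has_vector_derivative intro!: has_vector_derivative_within_subset[of _ _ _ "{0..S}" "{a..b}"])
      then have "0 \<le> \<theta> b - \<theta> a"
        by (rule has_integral_nonneg) (use that \<rho>0 in \<open>auto intro: less_imp_le\<close>)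
      then show ?thesis by simp
    qed
    show ?thesis using mono[of 0 s] mono[of s S] that \<theta>0 \<theta>S by auto
  qed
  have img: "\<theta> ` ?I \<subseteq> {0..T}" using \<theta>T by auto
  have chain: "((\<lambda>s. F (\<theta> s)) has_vector_derivative \<rho> s *\<^sub>R F') (at s within ?I)"
    if "s \<in> ?I" "(F has_vector_derivative F') (at (\<theta> s) within {0..T})"
    for F :: "real \<Rightarrow> 'c::real_normed_vector" and F' s
  proof -
    have "(\<theta> has_vector_derivative \<rho> s) (at s within ?I)"
      using \<theta>[OF that(1)] by (simp add: has_real_derivative_iff_has_vector_derivative)
    from vector_diff_chain_within[OF this has_vector_derivative_within_subset[OF that(2) img]]
    show ?thesis by (simp add: o_def)
  qed
  have zb': "((\<lambda>s. zb (\<theta> s)) has_vector_derivative \<rho> s *\<^sub>R wb (\<theta> s)) (at s within ?I)" if "s \<in> ?I" for s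
    unfolding zb_def wb_def using \<theta>T[OF that] by (intro chain that extremal_layer1_derivative)
  have wb': "((\<lambda>s. wb (\<theta> s)) has_vector_derivative \<rho> s *\<^sub>R - A (wb (\<theta> s))) (at s within ?I)" if "s \<in> ?I" for s
    unfolding wb_def A by (intro chain that extremal_control_derivative)
  have tb': "((\<lambda>s. tb (\<theta> s)) has_vector_derivative \<rho> s *\<^sub>R Qform (zb (\<theta> s)) (wb (\<theta> s))) (at s within ?I)" if "s \<in> ?I" for s
    unfolding tb_def zb_def wb_def using \<theta>T[OF that] by (intro chain that extremal_layer2_derivative)
  have contzb: "continuous_on ?I (\<lambda>s. zb (\<theta> s))" and contwb: "continuous_on ?I (\<lambda>s. wb (\<theta> s))"
    using continuous_on_vector_derivative[OF zb'] continuous_on_vector_derivative[OF wb'] by auto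
  have contA: "continuous_on X (\<lambda>s. A (f s))" if "continuous_on X f" for X and f :: "real \<Rightarrow> _"
    unfolding A by (rule linear_continuous_on_compose[OF that linear_Aop])
  have Lzb: "\<exists>L. L-lipschitz_on ?I (\<lambda>s. zb (\<theta> s))"
    by (rule C1_lipschitz_on_ivl[OF zb']) (auto intro!: continuous_intros \<rho>c contwb)
  have Lwb: "\<exists>L. L-lipschitz_on ?I (\<lambda>s. wb (\<theta> s))"
    by (rule C1_lipschitz_on_ivl[OF wb']) (auto intro!: continuous_intros \<rho>c contwb contA)
  have Ltb: "\<exists>L. L-lipschitz_on ?I (\<lambda>s. tb (\<theta> s))"
    by (rule C1_lipschitz_on_ivl[OF tb'])
       (auto intro!: continuous_intros \<rho>c contwb contzb bounded_bilinear.continuous_on[OF bounded_bilinear_Qform])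
  obtain L where L: "L-lipschitz_on ?I \<gamma>" using hor by (auto simp: horizontal_def)
  have Lfst: "\<exists>L. L-lipschitz_on ?I (\<lambda>s. fst (\<gamma> s))"
    by (rule linear_lipschitz_on[OF linear_fst]) (use L in blast)
  have Lsnd: "\<exists>L. L-lipschitz_on ?I (\<lambda>s. snd (\<gamma> s))"
    by (rule linear_lipschitz_on[OF linear_snd]) (use L in blast)
  have L\<delta>: "\<exists>L. L-lipschitz_on ?I \<delta>"
    unfolding \<delta>_def[abs_def] using Lfst Lzb lipschitz_on_diff by blast
  have LA\<delta>: "\<exists>L. L-lipschitz_on ?I (\<lambda>s. A (\<delta> s))"
    unfolding A by (rule linear_lipschitz_on[OF linear_Aop L\<delta>])
  have LN: "\<exists>L. L-lipschitz_on ?I (\<lambda>s. A (\<delta> s) \<bullet> A (\<delta> s))"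
    by (rule lipschitz_on_ivl_inner[OF LA\<delta> LA\<delta>])
  have L1: "\<exists>L. L-lipschitz_on ?I (\<lambda>s. \<delta> s \<bullet> (wb (\<theta> s) + (\<xi>, \<eta>)))"
  proof (rule lipschitz_on_ivl_inner[OF L\<delta>])
    show "\<exists>M. M-lipschitz_on ?I (\<lambda>s. wb (\<theta> s) + (\<xi>, \<eta>))"
      using Lwb lipschitz_on_add[OF _ lipschitz_on_constant] by blast
  qed
  have L2: "\<exists>L. L-lipschitz_on ?I (\<lambda>s. 2 *\<^sub>R \<tau> \<bullet> (snd (\<gamma> s) - tb (\<theta> s)))"
  proof (rule lipschitz_on_ivl_inner)
    show "\<exists>L. L-lipschitz_on ?I (\<lambda>s. 2 *\<^sub>R \<tau>)" using lipschitz_on_constant by blast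
    show "\<exists>L. L-lipschitz_on ?I (\<lambda>s. snd (\<gamma> s) - tb (\<theta> s))" using Lsnd Ltb lipschitz_on_diff by blast
  qed
  have w_meas: "w \<in> borel_measurable ?M" using hor by (simp add: horizontal_def)
  obtain B where B: "AE s in ?M. norm (w s) \<le> B" using hor by (auto simp: horizontal_def)
  have ic: "integrable ?M f" if "continuous_on ?I f" for f :: "real \<Rightarrow> real"
    using that by (rule continuous_imp_integrable_real)
  have contA\<delta>: "continuous_on ?I (\<lambda>s. A (\<delta> s))" using LA\<delta> lipschitz_on_continuous_on by blast
  have i1: "integrable ?M (\<lambda>s. (norm (w s))\<^sup>2 / \<rho> s)"
  proof -
    have "continuous_on ?I (\<lambda>s. 1 / \<rho> s)"
      using \<rho>0 by (intro continuous_intros \<rho>c) (auto simp: less_imp_neq[symmetric])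
    then have "bounded ((\<lambda>s. 1 / \<rho> s) ` ?I)"
      by (intro compact_imp_bounded compact_continuous_image) auto
    then obtain R where R: "\<forall>s\<in>?I. \<bar>1 / \<rho> s\<bar> \<le> R" by (auto simp: bounded_iff)
    show ?thesis
    proof (rule integrable_lebesgue_on_bounded)
      have "\<rho> \<in> borel_measurable ?M"
        by (rule continuous_imp_measurable_on_sets_lebesgue[OF \<rho>c]) simp
      then show "(\<lambda>s. (norm (w s))\<^sup>2 / \<rho> s) \<in> borel_measurable ?M" using w_meas by measurable
      have sp: "AE s in ?M. s \<in> ?I" by (rule AE_I2) (simp add: space_restrict_space)
      from B sp show "AE s in ?M. norm ((norm (w s))\<^sup>2 / \<rho> s) \<le> B\<^sup>2 * R"
      proof eventually_elim
        case (elim s)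
        have "norm ((norm (w s))\<^sup>2 / \<rho> s) = (norm (w s))\<^sup>2 * \<bar>1 / \<rho> s\<bar>" by (simp add: abs_mult)
        also have "\<dots> \<le> B\<^sup>2 * R" using elim R by (intro mult_mono power_mono) auto
        finally show ?case .
      qed
    qed
  qed
  have i2: "integrable ?M (\<lambda>s. \<rho> s * c\<^sup>2)" by (intro ic continuous_intros \<rho>c)
  have i3: "integrable ?M (\<lambda>s. \<rho> s * (norm (A (\<delta> s)))\<^sup>2 / \<omega>\<^sup>2)"
    using \<omega> by (intro ic continuous_intros \<rho>c contA\<delta>) auto
  define E where "E = (LINT s|?M. (norm (w s))\<^sup>2 / \<rho> s)"
  define N where "N = (LINT s|?M. \<rho> s * (norm (A (\<delta> s)))\<^sup>2 / \<omega>\<^sup>2)"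
  have int\<rho>: "(LINT s|?M. \<rho> s * c\<^sup>2) = T * c\<^sup>2"
  proof -
    have "(\<rho> has_integral \<theta> S - \<theta> 0) ?I"
      using S \<theta> by (intro fundamental_theorem_of_calculus) (auto simp: has_real_derivative_iff_has_vector_derivative)
    then have "integral ?I \<rho> = T" using \<theta>0 \<theta>S by (simp add: integral_unique)
    moreover have "(LINT s|?M. \<rho> s) = integral ?I \<rho>" by (rule lebesgue_integral_eq_integral[OF ic[OF \<rho>c]]) simp
    ultimately show ?thesis by simp
  qed
  have key: "0 \<le> E - T * c\<^sup>2 + ((\<omega> / 2)\<^sup>2 - \<kappa>\<^sup>2) * N" if \<kappa>: "0 < \<kappa>" "\<kappa> < \<omega> / 2" for \<kappa>
  proof -
    have \<kappa>T: "\<kappa> * T < pi"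
      using mult_strict_right_mono[OF \<kappa>(2) Tpos] \<omega> by (simp add: T \<omega>_def[symmetric])
    define C where "C = (\<lambda>u. \<kappa> * cot (\<kappa> * u + (pi - \<kappa> * T) / 2))"
    have C': "((\<lambda>s. C (\<theta> s)) has_vector_derivative \<rho> s *\<^sub>R (- \<kappa>\<^sup>2 - (C (\<theta> s))\<^sup>2)) (at s within ?I)" if "s \<in> ?I" for s
    proof (rule chain[OF that])
      show "(C has_vector_derivative (- \<kappa>\<^sup>2 - (C (\<theta> s))\<^sup>2)) (at (\<theta> s) within {0..T})"
        using shifted_cot[OF \<kappa>(1) \<kappa>T \<theta>T[OF that]] unfolding C_def
        by (simp add: has_real_derivative_iff_has_vector_derivative has_vector_derivative_at_within)
    qed
    have contC: "continuous_on ?I (\<lambda>s. C (\<theta> s))" by (rule continuous_on_vector_derivative[OF C'])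
    have LC: "\<exists>L. L-lipschitz_on ?I (\<lambda>s. C (\<theta> s))"
      by (rule C1_lipschitz_on_ivl[OF C']) (auto intro!: continuous_intros \<rho>c contC)
    \<comment> \<open>All three summands vanish at both endpoints. The first one completes the square, and the
      derivatives of the others contribute the constraint along \<open>\<tau>\<close> and the first variation.\<close>
    define G where "G s = C (\<theta> s) * (A (\<delta> s) \<bullet> A (\<delta> s)) * (1 / \<omega>\<^sup>2)
        + 2 *\<^sub>R \<tau> \<bullet> (snd (\<gamma> s) - tb (\<theta> s)) + \<delta> s \<bullet> (wb (\<theta> s) + (\<xi>, \<eta>))" for s
    have "\<exists>L. L-lipschitz_on ?I G"
    proof -
      have "\<exists>L. L-lipschitz_on ?I (\<lambda>s. C (\<theta> s) \<bullet> (A (\<delta> s) \<bullet> A (\<delta> s)))"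
        by (rule lipschitz_on_ivl_inner[OF LC LN])
      then have "\<exists>L. L-lipschitz_on ?I (\<lambda>s. (C (\<theta> s) \<bullet> (A (\<delta> s) \<bullet> A (\<delta> s))) \<bullet> (1 / \<omega>\<^sup>2))"
        by (rule lipschitz_on_ivl_inner) (use lipschitz_on_constant in blast)
      then have "\<exists>L. L-lipschitz_on ?I (\<lambda>s. C (\<theta> s) * (A (\<delta> s) \<bullet> A (\<delta> s)) * (1 / \<omega>\<^sup>2))"
        by (simp add: inner_real_def)
      then show ?thesis
        unfolding G_def[abs_def] using L1 L2 lipschitz_on_add by blast
    qed
    then obtain LG where LG: "LG-lipschitz_on ?I G" ..
    define H where "H s = (norm (w s))\<^sup>2 / \<rho> s - \<rho> s * c\<^sup>2 + ((\<omega> / 2)\<^sup>2 - \<kappa>\<^sup>2) * (\<rho> s * (norm (A (\<delta> s)))\<^sup>2 / \<omega>\<^sup>2)" for s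
    have H: "integrable ?M H"
      unfolding H_def[abs_def] by (intro Bochner_Integration.integrable_add Bochner_Integration.integrable_diff i1 i2 integrable_mult_right i3)
    have "G S - G 0 \<le> (LINT s|?M. H s)"
    proof (rule lipschitz_increment_le_integral[OF _ LG _ H])
      have sp: "AE s in ?M. s \<in> ?I" by (rule AE_I2) (simp add: space_restrict_space)
      have "AE s in ?M. (\<gamma> has_vector_derivative (w s, Qform (fst (\<gamma> s)) (w s))) (at s within ?I)"
        using hor by (simp add: horizontal_def)
      then show "AE s in ?M. \<exists>d. (G has_real_derivative d) (at s within ?I) \<and> d \<le> H s"
        using sp
      proof eventually_elim
        case (elim s)
        define d where "d = w s - \<rho> s *\<^sub>R wb (\<theta> s)"
        have w_eq: "w s = d + \<rho> s *\<^sub>R wb (\<theta> s)" by (simp add: d_def)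
        have z_eq: "fst (\<gamma> s) = \<delta> s + zb (\<theta> s)" by (simp add: \<delta>_def)
        have dd: "(\<delta> has_vector_derivative d) (at s within ?I)"
          unfolding \<delta>_def[abs_def] d_def by (intro has_vector_derivative_diff fst_derivative[OF elim(1)] zb' elim(2))
        then have dA: "((\<lambda>s. A (\<delta> s)) has_vector_derivative A d) (at s within ?I)"
          unfolding A by (rule bounded_linear.has_vector_derivative[OF bounded_linear_Aop])
        let ?G' = "(C (\<theta> s) * (A (\<delta> s) \<bullet> A d + A d \<bullet> A (\<delta> s)) + \<rho> s *\<^sub>R (- \<kappa>\<^sup>2 - (C (\<theta> s))\<^sup>2) * (A (\<delta> s) \<bullet> A (\<delta> s))) * (1 / \<omega>\<^sup>2)
          + 2 *\<^sub>R \<tau> \<bullet> (Qform (fst (\<gamma> s)) (w s) - \<rho> s *\<^sub>R Qform (zb (\<theta> s)) (wb (\<theta> s)))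
          + (\<delta> s \<bullet> (\<rho> s *\<^sub>R - A (wb (\<theta> s)) + 0) + d \<bullet> (wb (\<theta> s) + (\<xi>, \<eta>)))"
        have "(G has_vector_derivative ?G') (at s within ?I)"
          unfolding G_def[abs_def]
          by (intro has_vector_derivative_add has_vector_derivative_mult_left has_vector_derivative_mult
              bounded_bilinear.has_vector_derivative[OF bounded_bilinear_inner]
              bounded_linear.has_vector_derivative[OF bounded_linear_inner_right]
              has_vector_derivative_diff dd dA C' wb' tb' snd_derivative[OF elim(1)] has_vector_derivative_const elim(2))
        moreover have "?G' \<le> H s"
        proof -
          have w0: "(\<xi>, \<eta>) = wb (\<theta> s) + A (zb (\<theta> s))"
            using extremal_control_plus_Aop_layer1[of "\<theta> s" \<xi> \<eta> \<tau>] \<theta>T[OF elim(2)]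
            by (simp add: wb_def zb_def A)
          have wc: "norm (wb (\<theta> s)) = c" by (simp add: wb_def c_def norm_extremal_control)
          have Q: "2 *\<^sub>R \<tau> \<bullet> (Qform (fst (\<gamma> s)) (w s) - \<rho> s *\<^sub>R Qform (zb (\<theta> s)) (wb (\<theta> s)))
            = (\<delta> s + zb (\<theta> s)) \<bullet> A (d + \<rho> s *\<^sub>R wb (\<theta> s)) - \<rho> s * (zb (\<theta> s) \<bullet> A (wb (\<theta> s)))"
            unfolding w_eq z_eq A inner_scaleR_left unfolding inner_diff_right inner_scaleR_right inner_Qform
            by simp
          have p1: "(C (\<theta> s) * (A (\<delta> s) \<bullet> A d + A d \<bullet> A (\<delta> s)) + \<rho> s *\<^sub>R (- \<kappa>\<^sup>2 - (C (\<theta> s))\<^sup>2) * (A (\<delta> s) \<bullet> A (\<delta> s))) * (1 / \<omega>\<^sup>2)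
            = \<rho> s * (- \<kappa>\<^sup>2 - (C (\<theta> s))\<^sup>2) * (norm (A (\<delta> s)))\<^sup>2 / \<omega>\<^sup>2 + 2 * C (\<theta> s) * (A (\<delta> s) \<bullet> A d) / \<omega>\<^sup>2"
            by (simp add: power2_norm_eq_inner inner_commute[of "A d" "A (\<delta> s)"] add_divide_distrib)
          have p3: "\<delta> s \<bullet> (\<rho> s *\<^sub>R - A (wb (\<theta> s)) + 0) + d \<bullet> (wb (\<theta> s) + (\<xi>, \<eta>))
            = d \<bullet> (2 *\<^sub>R wb (\<theta> s) + A (zb (\<theta> s))) - \<rho> s * (\<delta> s \<bullet> A (wb (\<theta> s)))"
            unfolding w0 by (simp add: inner_add_right)
          have Hs: "H s = (norm (d + \<rho> s *\<^sub>R wb (\<theta> s)))\<^sup>2 / \<rho> s - \<rho> s * c\<^sup>2 + \<rho> s * ((\<omega> / 2)\<^sup>2 - \<kappa>\<^sup>2) * (norm (A (\<delta> s)))\<^sup>2 / \<omega>\<^sup>2"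
            unfolding H_def w_eq by simp
          have "?G' + (norm (d + (\<rho> s / 2) *\<^sub>R A (\<delta> s) + (\<rho> s * C (\<theta> s) / \<omega>\<^sup>2) *\<^sub>R A (A (\<delta> s))))\<^sup>2 / \<rho> s = H s"
            using completed_square[OF \<tau> \<rho>0[OF elim(2)], of \<kappa> "C (\<theta> s)" "\<delta> s" d "zb (\<theta> s)" "wb (\<theta> s)",
                folded A \<omega>_def]
            unfolding p1 Q p3 Hs wc by linarith
          moreover have "(norm (d + (\<rho> s / 2) *\<^sub>R A (\<delta> s) + (\<rho> s * C (\<theta> s) / \<omega>\<^sup>2) *\<^sub>R A (A (\<delta> s))))\<^sup>2 / \<rho> s \<ge> 0"
            using \<rho>0[OF elim(2)] by simp
          ultimately show ?thesis by linarith
        qed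
        ultimately show ?case by (auto simp: has_real_derivative_iff_has_vector_derivative)
      qed
    qed (use S in simp)
    moreover have "G 0 = 0"
      by (simp add: G_def \<delta>_def \<gamma>0 \<theta>0 zb_def tb_def extremal_layer1_0 extremal_0 A Aop_simps)
    moreover have "G S = 0"
      by (simp add: G_def \<delta>_def \<gamma>S \<theta>S zb_def tb_def fst_extremal A Aop_simps)
    moreover have "(LINT s|?M. H s) = E - T * c\<^sup>2 + ((\<omega> / 2)\<^sup>2 - \<kappa>\<^sup>2) * N"
    proof -
      have "(LINT s|?M. H s) = (LINT s|?M. (norm (w s))\<^sup>2 / \<rho> s - \<rho> s * c\<^sup>2)
          + (LINT s|?M. ((\<omega> / 2)\<^sup>2 - \<kappa>\<^sup>2) * (\<rho> s * (norm (A (\<delta> s)))\<^sup>2 / \<omega>\<^sup>2))"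
        unfolding H_def by (intro Bochner_Integration.integral_add Bochner_Integration.integrable_diff i1 i2 integrable_mult_right i3)
      also have "(LINT s|?M. (norm (w s))\<^sup>2 / \<rho> s - \<rho> s * c\<^sup>2) = E - T * c\<^sup>2"
        unfolding E_def by (simp only: Bochner_Integration.integral_diff[OF i1 i2] int\<rho>)
      finally show ?thesis by (simp only: integral_mult_right_zero N_def)
    qed
    ultimately show ?thesis by simp
  qed
  have "((\<lambda>\<kappa>. E - T * c\<^sup>2 + ((\<omega> / 2)\<^sup>2 - \<kappa>\<^sup>2) * N) \<longlongrightarrow> E - T * c\<^sup>2 + ((\<omega> / 2)\<^sup>2 - (\<omega> / 2)\<^sup>2) * N) (at_left (\<omega> / 2))"
    by (intro tendsto_intros)
  moreover have "\<forall>\<^sub>F \<kappa> in at_left (\<omega> / 2). 0 \<le> E - T * c\<^sup>2 + ((\<omega> / 2)\<^sup>2 - \<kappa>\<^sup>2) * N"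
    using key \<omega> by (auto simp: eventually_at_left[of 0 "\<omega> / 2"] intro!: exI[of _ 0])
  ultimately have "0 \<le> E - T * c\<^sup>2 + ((\<omega> / 2)\<^sup>2 - (\<omega> / 2)\<^sup>2) * N"
    by (intro tendsto_lowerbound) auto
  then show ?thesis by (simp add: E_def c_def mult.commute)
qed

lemma continuous_weights_approximation:
  fixes f :: "real \<Rightarrow> real"
  assumes f: "f \<in> borel_measurable (lebesgue_on {a..b})" and "AE s in lebesgue_on {a..b}. 0 \<le> f s \<and> f s \<le> B"
  obtains r where "\<And>n. continuous_on {a..b} (r n)" "\<And>n s. 0 \<le> r n s \<and> r n s \<le> \<bar>B\<bar>"
    "AE s in lebesgue_on {a..b}. (\<lambda>n. r n s) \<longlonglongrightarrow> f s"
proof -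
  have "f measurable_on {a..b}" using f by (simp add: measurable_on_iff_borel_measurable)
  then obtain N g where N: "negligible N" and g: "\<And>n. continuous_on UNIV (g n)"
    and lim: "\<And>x. x \<notin> N \<Longrightarrow> (\<lambda>n. g n x) \<longlonglongrightarrow> (if x \<in> {a..b} then f x else 0)"
    unfolding measurable_on_def by metis
  show ?thesis
  proof (rule that[of "\<lambda>n s. max 0 (min \<bar>B\<bar> (g n s))"])
    show "continuous_on {a..b} (\<lambda>s. max 0 (min \<bar>B\<bar> (g n s)))" for n
      by (intro continuous_intros continuous_on_subset[OF g]) auto
    have "AE s in lebesgue_on {a..b}. (\<lambda>n. g n s) \<longlonglongrightarrow> f s"
      by (rule AE_lebesgue_onI[OF _ N]) (use lim in force)+
    with assms(2) show "AE s in lebesgue_on {a..b}. (\<lambda>n. max 0 (min \<bar>B\<bar> (g n s))) \<longlonglongrightarrow> f s"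
    proof eventually_elim
      case (elim s)
      have "(\<lambda>n. max 0 (min \<bar>B\<bar> (g n s))) \<longlonglongrightarrow> max 0 (min \<bar>B\<bar> (f s))"
        by (intro tendsto_max tendsto_min tendsto_const elim)
      then show ?case using elim by (simp add: min_absorb2)
    qed
  qed auto
qed

text \<open>
  By Cauchy-Schwarz the square of the length is the infimum of energy times duration over all
  reparametrizations, the optimal weight being the speed of the curve. This speed is
  neither continuous nor bounded away from zero, so continuous functions
  converging almost everywhere to it, increased by a constant \<open>e > 0\<close>, serve as weights; at the end
  \<open>e\<close> tends to zero.
\<close>
lemma length_lower_bound:
  fixes \<gamma> :: "real \<Rightarrow> ('q::finite, 'p::finite) carnot"
  assumes \<tau>: "\<tau> \<noteq> 0" and S: "0 < S" and hor: "horizontal S \<gamma> w"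
    and \<gamma>0: "\<gamma> 0 = 0" and \<gamma>S: "\<gamma> S = extremal \<xi> \<eta> \<tau> T" and T: "T = 2 * pi / norm \<tau>"
  shows "norm (\<xi>, \<eta>) * T \<le> horizontal_length S w"
proof -
  let ?I = "{0..S}" and ?M = "lebesgue_on {0..S}"
  define c where "c = norm (\<xi>, \<eta>)"
  define f where "f s = norm (w s)" for s
  define l where "l = (LINT s|?M. f s)"
  have Tpos: "T > 0" using T \<tau> by simp
  have w_meas: "w \<in> borel_measurable ?M" using hor by (simp add: horizontal_def)
  then have f_meas: "f \<in> borel_measurable ?M" unfolding f_def[abs_def] by measurable
  obtain B where "AE s in ?M. norm (w s) \<le> B" using hor by (auto simp: horizontal_def)
  then have fB: "AE s in ?M. 0 \<le> f s \<and> f s \<le> B" by eventually_elim (simp add: f_def)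
  obtain r where rc: "\<And>n. continuous_on ?I (r n)" and rb: "\<And>n s. 0 \<le> r n s \<and> r n s \<le> \<bar>B\<bar>"
    and rlim: "AE s in ?M. (\<lambda>n. r n s) \<longlonglongrightarrow> f s"
    using continuous_weights_approximation[OF f_meas fB] by metis
  have r_meas: "r n \<in> borel_measurable ?M" for n
    by (rule continuous_imp_measurable_on_sets_lebesgue[OF rc]) simp
  have fi: "integrable ?M f"
    by (rule integrable_lebesgue_on_bounded[OF f_meas, of B]) (use fB in \<open>eventually_elim, auto\<close>)
  have ci: "integrable ?M (\<lambda>_. K)" for K :: real
    by (rule continuous_imp_integrable_real) simp
  have l0: "l \<ge> 0" unfolding l_def f_def by simp
  have step: "c\<^sup>2 * T\<^sup>2 \<le> (e * S + l) * l" if e: "e > 0" for e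
  proof -
    let ?\<rho> = "\<lambda>n s. e + r n s"
    define I where "I n = (LINT s|?M. ?\<rho> n s)" for n
    define J where "J n = (LINT s|?M. (f s)\<^sup>2 / ?\<rho> n s)" for n
    have pos: "?\<rho> n s > 0" for n s using rb[of n s] e by linarith
    have \<rho>c: "continuous_on ?I (?\<rho> n)" for n by (intro continuous_intros rc)
    have Ieq: "I n = integral ?I (?\<rho> n)" for n
      unfolding I_def by (rule lebesgue_integral_eq_integral[OF continuous_imp_integrable_real[OF \<rho>c]]) simp
    have Ipos: "I n > 0" for n
    proof -
      have "integral ?I (\<lambda>_. e) \<le> integral ?I (?\<rho> n)"
        using rb by (intro integral_le integrable_continuous_real \<rho>c) auto
      then show ?thesis using S mult_pos_pos[OF S e] by (simp add: Ieq)
    qed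
    have le: "c\<^sup>2 * T\<^sup>2 \<le> I n * J n" for n
    proof -
      \<comment> \<open>The factor that makes the total mass of the weight equal to the period.\<close>
      define k where "k = T / I n"
      have k: "k > 0" using Tpos Ipos by (simp add: k_def)
      have "c\<^sup>2 * T \<le> (LINT s|?M. (norm (w s))\<^sup>2 / (k * ?\<rho> n s))"
        unfolding c_def
      proof (rule weighted_energy_lower_bound[OF \<tau> S hor \<gamma>0 \<gamma>S T, where \<theta> = "\<lambda>s. k * integral {0..s} (?\<rho> n)"])
        show "((\<lambda>s. k * integral {0..s} (?\<rho> n)) has_real_derivative k * ?\<rho> n s) (at s within ?I)" if "s \<in> ?I" for s
          by (intro DERIV_cmult integral_has_real_derivative \<rho>c that)
        show "k * integral {0..S} (?\<rho> n) = T" using Ipos[of n] by (simp add: k_def Ieq)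
      qed (use k pos in \<open>auto intro!: continuous_intros rc\<close>)
      also have "\<dots> = (LINT s|?M. (1 / k) * ((f s)\<^sup>2 / ?\<rho> n s))" by (simp add: f_def)
      also have "\<dots> = J n / k" by (simp only: integral_mult_right_zero J_def) simp
      finally have "c\<^sup>2 * T * T \<le> I n * J n"
        using k Ipos[of n] Tpos by (simp add: k_def field_simps)
      then show ?thesis by (simp add: power2_eq_square mult.assoc)
    qed
    have I_lim: "I \<longlonglongrightarrow> (LINT s|?M. e + f s)"
      unfolding I_def
    proof (rule integral_dominated_convergence[where w = "\<lambda>_. e + \<bar>B\<bar>"])
      show "AE s in ?M. (\<lambda>n. ?\<rho> n s) \<longlonglongrightarrow> e + f s"
        using rlim by eventually_elim (intro tendsto_intros)
      show "AE s in ?M. norm (?\<rho> n s) \<le> e + \<bar>B\<bar>" for n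
        using rb[of n] pos[of n] e by (intro AE_I2) (auto simp: abs_of_pos)
    qed (use f_meas r_meas ci in \<open>auto intro: borel_measurable_add\<close>)
    have J_lim: "J \<longlonglongrightarrow> (LINT s|?M. (f s)\<^sup>2 / (e + f s))"
      unfolding J_def
    proof (rule integral_dominated_convergence[where w = "\<lambda>_. B\<^sup>2 / e"])
      show "AE s in ?M. (\<lambda>n. (f s)\<^sup>2 / ?\<rho> n s) \<longlonglongrightarrow> (f s)\<^sup>2 / (e + f s)"
        using rlim
      proof eventually_elim
        case (elim s)
        then show ?case using e by (intro tendsto_intros) (auto simp: f_def add_pos_nonneg less_imp_neq[symmetric])
      qed
      show "AE s in ?M. norm ((f s)\<^sup>2 / ?\<rho> n s) \<le> B\<^sup>2 / e" for n
        using fB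
      proof eventually_elim
        case (elim s)
        have "norm ((f s)\<^sup>2 / ?\<rho> n s) = (f s)\<^sup>2 / ?\<rho> n s" using pos[of n s] by simp
        also have "\<dots> \<le> B\<^sup>2 / e" using elim e rb[of n s] by (intro frac_le power_mono) auto
        finally show ?case .
      qed
    qed (use f_meas r_meas ci in measurable)
    have "c\<^sup>2 * T\<^sup>2 \<le> (LINT s|?M. e + f s) * (LINT s|?M. (f s)\<^sup>2 / (e + f s))"
      by (rule tendsto_lowerbound[OF tendsto_mult[OF I_lim J_lim]]) (use le in auto)
    moreover have "(LINT s|?M. e + f s) = e * S + l"
    proof -
      have "(LINT s|?M. e + f s) = (LINT s|?M. e) + l"
        unfolding l_def by (rule Bochner_Integration.integral_add[OF ci fi])
      also have "(LINT s|?M. e) = e * S" using S by (simp add: measure_restrict_space)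
      finally show ?thesis .
    qed
    moreover have "(LINT s|?M. (f s)\<^sup>2 / (e + f s)) \<le> l"
      unfolding l_def
    proof (rule integral_mono')
      show "(f s)\<^sup>2 / (e + f s) \<le> f s" for s
        using e by (simp add: f_def power2_eq_square divide_le_eq add_pos_nonneg)
          (simp add: algebra_simps)
    qed (rule fi | simp add: f_def)+
    moreover have "0 \<le> e * S + l" using e S l0 by simp
    ultimately show ?thesis by (auto intro: order_trans mult_left_mono)
  qed
  have "((\<lambda>e. (e * S + l) * l) \<longlongrightarrow> (0 * S + l) * l) (at_right 0)"
    by (intro tendsto_intros)
  then have "c\<^sup>2 * T\<^sup>2 \<le> (0 * S + l) * l"
    by (rule tendsto_lowerbound) (use step in \<open>auto simp: eventually_at_right[of 0 1] intro!: exI[of _ 1]\<close>)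
  then have "(c * T)\<^sup>2 \<le> l\<^sup>2" by (simp add: power2_eq_square mult_ac)
  then have "c * T \<le> l" using l0 by (rule power2_le_imp_le)
  then show ?thesis by (simp add: c_def l_def f_def horizontal_length_eq_norm)
qed

section \<open>Minimizing extremals and straight lines\<close>

lemma integrable_norm_control:
  assumes "horizontal T \<gamma> w"
  shows "integrable (lebesgue_on {0..T}) (\<lambda>s. norm (w s))"
proof -
  obtain B where B: "AE s in lebesgue_on {0..T}. norm (w s) \<le> B" using assms by (auto simp: horizontal_def)
  have "w \<in> borel_measurable (lebesgue_on {0..T})" using assms by (simp add: horizontal_def)
  then show ?thesis
    using B by (intro integrable_lebesgue_on_bounded[of _ _ _ B]) auto
qed

text \<open>
  The definition of a minimizing curve leaves the control open; two controls of the same curve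
  agree almost everywhere.
\<close>
lemma horizontal_control_unique:
  assumes "0 < T" "horizontal T \<gamma> w" "horizontal T \<gamma> w'"
  shows "horizontal_length T w = horizontal_length T w'"
  unfolding horizontal_length_eq_norm
proof (rule integral_cong_AE)
  have "w \<in> borel_measurable (lebesgue_on {0..T})" "w' \<in> borel_measurable (lebesgue_on {0..T})"
    using assms by (auto simp: horizontal_def)
  then show "(\<lambda>s. norm (w s)) \<in> borel_measurable (lebesgue_on {0..T})"
    "(\<lambda>s. norm (w' s)) \<in> borel_measurable (lebesgue_on {0..T})" by measurable
  have "AE s in lebesgue_on {0..T}. (\<gamma> has_vector_derivative (w s, Qform (fst (\<gamma> s)) (w s))) (at s within {0..T})"
    "AE s in lebesgue_on {0..T}. (\<gamma> has_vector_derivative (w' s, Qform (fst (\<gamma> s)) (w' s))) (at s within {0..T})"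
    using assms by (auto simp: horizontal_def)
  moreover have "AE s in lebesgue_on {0..T}. s \<in> {0..T}" by (rule AE_I2) (simp add: space_restrict_space)
  ultimately show "AE s in lebesgue_on {0..T}. norm (w s) = norm (w' s)"
  proof eventually_elim
    case (elim s)
    have "(w s, Qform (fst (\<gamma> s)) (w s)) = (w' s, Qform (fst (\<gamma> s)) (w' s))"
      by (rule vector_derivative_unique_within_closed_interval[of 0 T s \<gamma>]) (use elim assms(1) in auto)
    then show ?case by simp
  qed
qed

text \<open>
  The extremal is itself one of the curves over which the distance is an infimum, and its length is
  its constant speed times the time.
\<close>
lemma minimizes_extremal_iff:
  fixes \<xi> :: "real^'p::finite^'q::finite"
  assumes s: "0 < s"
  shows "minimizes_length (extremal \<xi> \<eta> \<tau>) s \<longleftrightarrow>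
    (\<forall>S \<gamma> w. 0 < S \<and> horizontal S \<gamma> w \<and> \<gamma> 0 = 0 \<and> \<gamma> S = extremal \<xi> \<eta> \<tau> s \<longrightarrow>
       norm (\<xi>, \<eta>) * s \<le> horizontal_length S w)"
proof -
  let ?X = "{horizontal_length S w | S \<gamma> w. 0 < S \<and> horizontal S \<gamma> w \<and> \<gamma> 0 = (0 :: ('q, 'p) carnot) \<and> \<gamma> S = extremal \<xi> \<eta> \<tau> s}"
  have d: "sr_dist (extremal \<xi> \<eta> \<tau> 0) (extremal \<xi> \<eta> \<tau> s) = Inf ?X"
    by (simp add: sr_dist_def extremal_0)
  have bdd: "bdd_below ?X"
    by (intro bdd_belowI[of _ 0]) (auto simp: horizontal_length_eq_norm)
  have mem: "norm (\<xi>, \<eta>) * s \<in> ?X"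
    using s horizontal_extremal[of s \<xi> \<eta> \<tau>] horizontal_length_extremal[of s \<xi> \<eta> \<tau>] extremal_0[of \<xi> \<eta> \<tau>]
    by (intro CollectI exI[of _ s] exI[of _ "extremal \<xi> \<eta> \<tau>"] exI[of _ "extremal_control \<xi> \<eta> \<tau>"]) auto
  have len: "horizontal_length s w = norm (\<xi>, \<eta>) * s" if "horizontal s (extremal \<xi> \<eta> \<tau>) w" for w
    using horizontal_control_unique[OF s that horizontal_extremal] s
    by (simp add: horizontal_length_extremal)
  have "minimizes_length (extremal \<xi> \<eta> \<tau>) s \<longleftrightarrow> norm (\<xi>, \<eta>) * s = Inf ?X"
    unfolding minimizes_length_def d using len horizontal_extremal[of s \<xi> \<eta> \<tau>] by auto
  also have "\<dots> \<longleftrightarrow> (\<forall>x\<in>?X. norm (\<xi>, \<eta>) * s \<le> x)"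
  proof
    assume "norm (\<xi>, \<eta>) * s = Inf ?X"
    then show "\<forall>x\<in>?X. norm (\<xi>, \<eta>) * s \<le> x" using cInf_lower[OF _ bdd] by auto
  next
    assume *: "\<forall>x\<in>?X. norm (\<xi>, \<eta>) * s \<le> x"
    show "norm (\<xi>, \<eta>) * s = Inf ?X"
      by (rule cInf_eq_minimum[OF mem, symmetric]) (rule *[rule_format])
  qed
  also have "\<dots> \<longleftrightarrow> (\<forall>S \<gamma> w. 0 < S \<and> horizontal S \<gamma> w \<and> \<gamma> 0 = 0 \<and> \<gamma> S = extremal \<xi> \<eta> \<tau> s \<longrightarrow>
       norm (\<xi>, \<eta>) * s \<le> horizontal_length S w)" by blast
  finally show ?thesis .
qed

text \<open>
  An extremal whose initial velocity lies in the kernel of \<open>Aop \<tau>\<close> projects to a straight segment in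
  the first layer, and no horizontal curve is shorter than the segment between the projections of
  its endpoints.
\<close>
lemma minimizes_degenerate:
  fixes \<xi> :: "real^'p::finite^'q::finite"
  assumes A: "Aop \<tau> (\<xi>, \<eta>) = 0" and s: "0 < s"
  shows "minimizes_length (extremal \<xi> \<eta> \<tau>) s"
  unfolding minimizes_extremal_iff[OF s]
proof (intro allI impI, elim conjE)
  fix S w and \<gamma> :: "real \<Rightarrow> ('q, 'p) carnot"
  assume S: "0 < S" and hor: "horizontal S \<gamma> w" and \<gamma>: "\<gamma> 0 = 0" "\<gamma> S = extremal \<xi> \<eta> \<tau> s"
  let ?v = "(\<xi>, \<eta>)" and ?M = "lebesgue_on {0..S}"
  have line: "extremal_layer1 \<xi> \<eta> \<tau> s = s *\<^sub>R ?v"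
  proof -
    have "(extremal_control \<xi> \<eta> \<tau> has_integral extremal_layer1 \<xi> \<eta> \<tau> s - extremal_layer1 \<xi> \<eta> \<tau> 0) {0..s}"
      using s by (intro fundamental_theorem_of_calculus extremal_layer1_derivative) auto
    moreover have "extremal_control \<xi> \<eta> \<tau> = (\<lambda>_. ?v)"
      using extremal_control_degenerate[OF A] by (simp add: fun_eq_iff)
    moreover have "((\<lambda>_. ?v) has_integral s *\<^sub>R ?v) {0..s}"
      using has_integral_const_real[of ?v 0 s] s by simp
    ultimately show ?thesis using has_integral_unique by (metis diff_zero extremal_layer1_0)
  qed
  obtain L where L: "L-lipschitz_on {0..S} \<gamma>" using hor by (auto simp: horizontal_def)
  have "\<exists>L. L-lipschitz_on {0..S} (\<lambda>r. fst (\<gamma> r) \<bullet> ?v)"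
  proof (rule lipschitz_on_ivl_inner)
    show "\<exists>L. L-lipschitz_on {0..S} (\<lambda>r. fst (\<gamma> r))"
      by (rule linear_lipschitz_on[OF linear_fst]) (use L in blast)
  qed (use lipschitz_on_constant in blast)
  then obtain L' where L': "L'-lipschitz_on {0..S} (\<lambda>r. fst (\<gamma> r) \<bullet> ?v)" ..
  have wi: "integrable ?M (\<lambda>r. norm (w r))" by (rule integrable_norm_control[OF hor])
  have "fst (\<gamma> S) \<bullet> ?v - fst (\<gamma> 0) \<bullet> ?v \<le> (LINT r|?M. norm (w r) * norm ?v)"
  proof (rule lipschitz_increment_le_integral[OF _ L'])
    have "AE r in ?M. (\<gamma> has_vector_derivative (w r, Qform (fst (\<gamma> r)) (w r))) (at r within {0..S})"
      using hor by (simp add: horizontal_def)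
    then show "AE r in ?M. \<exists>d. ((\<lambda>r. fst (\<gamma> r) \<bullet> ?v) has_real_derivative d) (at r within {0..S})
        \<and> d \<le> norm (w r) * norm ?v"
    proof eventually_elim
      case (elim r)
      have "((\<lambda>r. fst (\<gamma> r) \<bullet> ?v) has_vector_derivative w r \<bullet> ?v) (at r within {0..S})"
        by (rule bounded_linear.has_vector_derivative[OF bounded_linear_inner_left fst_derivative[OF elim]])
      moreover have "w r \<bullet> ?v \<le> norm (w r) * norm ?v" by (rule norm_cauchy_schwarz)
      ultimately show ?case by (auto simp: has_real_derivative_iff_has_vector_derivative)
    qed
  qed (use S wi in auto)
  also have "(LINT r|?M. norm (w r) * norm ?v) = horizontal_length S w * norm ?v"
    by (simp add: horizontal_length_eq_norm)
  also have "fst (\<gamma> S) \<bullet> ?v - fst (\<gamma> 0) \<bullet> ?v = (norm ?v * s) * norm ?v"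
    unfolding \<gamma> fst_extremal line inner_scaleR_left power2_norm_eq_inner[symmetric]
    by (simp add: power2_eq_square)
  finally have "(norm ?v * s) * norm ?v \<le> horizontal_length S w * norm ?v" .
  moreover have "horizontal_length S w \<ge> 0" by (simp add: horizontal_length_eq_norm)
  ultimately show "norm ?v * s \<le> horizontal_length S w"
    using mult_right_le_imp_le[of "norm ?v * s" "norm ?v" "horizontal_length S w"]
    by (cases "norm ?v = 0") (simp, force)
qed

section \<open>Loss of minimality after one period\<close>

text \<open>
  Replacing an initial piece of a curve changes its length by the difference of the lengths of the
  initial pieces, since the remainder is common.
\<close>
lemma horizontal_concat:
  fixes \<gamma>1 \<gamma>2 :: "real \<Rightarrow> ('q::finite, 'p::finite) carnot"
  assumes L: "0 < L" "L < s" and h1: "horizontal L \<gamma>1 w1" and h2: "horizontal s \<gamma>2 w2"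
    and eq: "\<gamma>1 L = \<gamma>2 L"
  defines "\<gamma> \<equiv> \<lambda>r. if r \<le> L then \<gamma>1 r else \<gamma>2 r" and "w \<equiv> \<lambda>r. if r \<le> L then w1 r else w2 r"
  shows "horizontal s \<gamma> w"
    and "horizontal_length s w - horizontal_length s w2 = horizontal_length L w1 - horizontal_length L w2"
proof -
  let ?M = "lebesgue_on {0..s}"
  obtain L1 L2 where L1: "L1-lipschitz_on {0..L} \<gamma>1" and L2: "L2-lipschitz_on {0..s} \<gamma>2"
    using h1 h2 by (auto simp: horizontal_def)
  obtain B1 B2 where "AE r in lebesgue_on {0..L}. norm (w1 r) \<le> B1" "AE r in ?M. norm (w2 r) \<le> B2"
    using h1 h2 by (auto simp: horizontal_def)
  then obtain N1 N2 where N1: "negligible N1" "\<And>r. r \<in> {0..L} - N1 \<Longrightarrow> norm (w1 r) \<le> B1"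
    and N2: "negligible N2" "\<And>r. r \<in> {0..s} - N2 \<Longrightarrow> norm (w2 r) \<le> B2"
    by (elim AE_lebesgue_on_negligibleE) auto
  have "AE r in lebesgue_on {0..L}. (\<gamma>1 has_vector_derivative (w1 r, Qform (fst (\<gamma>1 r)) (w1 r))) (at r within {0..L})"
    "AE r in ?M. (\<gamma>2 has_vector_derivative (w2 r, Qform (fst (\<gamma>2 r)) (w2 r))) (at r within {0..s})"
    using h1 h2 by (auto simp: horizontal_def)
  then obtain N3 N4 where
    N3: "negligible N3" "\<And>r. r \<in> {0..L} - N3 \<Longrightarrow> (\<gamma>1 has_vector_derivative (w1 r, Qform (fst (\<gamma>1 r)) (w1 r))) (at r within {0..L})"
    and N4: "negligible N4" "\<And>r. r \<in> {0..s} - N4 \<Longrightarrow> (\<gamma>2 has_vector_derivative (w2 r, Qform (fst (\<gamma>2 r)) (w2 r))) (at r within {0..s})"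
    by (elim AE_lebesgue_on_negligibleE) auto
  show hor: "horizontal s \<gamma> w"
    unfolding horizontal_def
  proof (intro conjI)
    have "(max L1 L2)-lipschitz_on {0..s} \<gamma>"
      unfolding \<gamma>_def
      by (rule lipschitz_on_concat[OF lipschitz_on_mono[OF L1] lipschitz_on_mono[OF L2] eq]) (use L in auto)
    then show "\<exists>L. L-lipschitz_on {0..s} \<gamma>" ..
    have "w1 \<in> borel_measurable (lebesgue_on {0..L})" using h1 by (simp add: horizontal_def)
    then have m1: "(\<lambda>r. if r \<in> {0..L} then w1 r else 0) \<in> borel_measurable ?M"
      using L by (subst borel_measurable_if_lebesgue_on) auto
    have m2: "w2 \<in> borel_measurable ?M" using h2 by (simp add: horizontal_def)
    have "(\<lambda>r. if r \<le> L then (if r \<in> {0..L} then w1 r else 0) else w2 r) \<in> borel_measurable ?M"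
    proof (rule measurable_If[OF m1 m2])
      have "{r \<in> space ?M. r \<le> L} = {0..L}" using L by (auto simp: space_restrict_space)
      also have "\<dots> \<in> sets ?M" using L by (auto simp: sets_restrict_space_iff)
      finally show "{r \<in> space ?M. r \<le> L} \<in> sets ?M" .
    qed
    then show "w \<in> borel_measurable ?M"
      by (rule measurable_cong[THEN iffD1, rotated]) (auto simp: w_def space_restrict_space)
    show "\<exists>B. AE r in ?M. norm (w r) \<le> B"
    proof (intro exI AE_lebesgue_onI)
      show "negligible (N1 \<union> N2)" using N1 N2 by simp
      show "norm (w r) \<le> max B1 B2" if "r \<in> {0..s} - (N1 \<union> N2)" for r
        using that N1(2)[of r] N2(2)[of r] by (auto simp: w_def)
    qed simp
    show "AE r in ?M. (\<gamma> has_vector_derivative (w r, Qform (fst (\<gamma> r)) (w r))) (at r within {0..s})"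
    proof (intro AE_lebesgue_onI)
      show "negligible (insert L (N3 \<union> N4))" using N3 N4 by simp
      fix r assume r: "r \<in> {0..s} - insert L (N3 \<union> N4)"
      show "(\<gamma> has_vector_derivative (w r, Qform (fst (\<gamma> r)) (w r))) (at r within {0..s})"
      proof (cases "r < L")
        case True
        have "at r within {0..s} = at r within {0..L}"
          by (rule at_within_nhd[of r "{..<L}"]) (use True L in auto)
        moreover have "(\<gamma> has_vector_derivative (w1 r, Qform (fst (\<gamma>1 r)) (w1 r))) (at r within {0..L})"
          by (rule has_vector_derivative_transform[OF _ _ N3(2)]) (use True r in \<open>auto simp: \<gamma>_def\<close>)
        ultimately show ?thesis using True by (simp add: \<gamma>_def w_def)
      next
        case False
        then have "L < r" using r by auto
        have "(\<gamma> has_vector_derivative (w2 r, Qform (fst (\<gamma>2 r)) (w2 r))) (at r within {0..s})"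
          by (rule has_vector_derivative_transform_within[OF N4(2), of _ "r - L"])
             (use \<open>L < r\<close> r in \<open>auto simp: \<gamma>_def dist_real_def\<close>)
        then show ?thesis using \<open>L < r\<close> by (simp add: \<gamma>_def w_def)
      qed
    qed simp
  qed
  have len: "horizontal_length T v = integral {0..T} (\<lambda>r. norm (v r))" if "horizontal T g v"
    for T v and g :: "real \<Rightarrow> ('q, 'p) carnot"
    unfolding horizontal_length_eq_norm
    by (rule lebesgue_integral_eq_integral[OF integrable_norm_control[OF that]]) simp
  have int: "(\<lambda>r. norm (v r)) integrable_on {0..s}" if "horizontal s g v" for v and g :: "real \<Rightarrow> ('q, 'p) carnot"
    using has_integral_integral_lebesgue_on[OF integrable_norm_control[OF that]] by (auto simp: integrable_on_def)
  have split: "horizontal_length s v = integral {0..L} (\<lambda>r. norm (v r)) + integral {L..s} (\<lambda>r. norm (v r))"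
    if "horizontal s g v" for v and g :: "real \<Rightarrow> ('q, 'p) carnot"
    unfolding len[OF that] by (rule Henstock_Kurzweil_Integration.integral_combine[symmetric, OF _ _ int[OF that]]) (use L in auto)
  have "integral {0..L} (\<lambda>r. norm (w r)) = integral {0..L} (\<lambda>r. norm (w1 r))"
    by (rule integral_cong) (auto simp: w_def)
  moreover have "integral {L..s} (\<lambda>r. norm (w r)) = integral {L..s} (\<lambda>r. norm (w2 r))"
    by (rule integral_spike[of "{L}"]) (auto simp: w_def)
  moreover have "horizontal_length L w2 = integral {0..L} (\<lambda>r. norm (w2 r))"
  proof -
    have "integrable (lebesgue_on {0..L}) (\<lambda>r. norm (w2 r))"
      by (rule integrable_subinterval[of 0 s]) (use L integrable_norm_control[OF h2] in auto)
    then show ?thesis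
      unfolding horizontal_length_eq_norm by (rule lebesgue_integral_eq_integral) simp
  qed
  ultimately show "horizontal_length s w - horizontal_length s w2 = horizontal_length L w1 - horizontal_length L w2"
    by (simp add: split[OF hor] split[OF h2] len[OF h1])
qed

text \<open>
  Past the period a shorter curve with the same endpoint is explicit. It is obtained by adding to the
  horizontal part a circular loop \<open>\<delta>\<close> in the plane spanned by \<open>(e u\<^sup>T, 0)\<close> and \<open>(0, u)\<close>,
  where \<open>e\<close> is the unit vector in the direction of \<open>\<tau>\<close>. The loop is traversed once, at the angular speed
  \<open>\<nu> = 2 pi / L\<close>, which is smaller than the angular speed \<open>\<omega>\<close> of the extremal, so the quadratic form of
  the deviation is negative on it.

  For \<open>\<sigma>\<close> orthogonal to \<open>\<tau>\<close>, the change of the vertical endpoint in the direction \<open>\<sigma>\<close> is proportional to the integral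
  of the second component of the loop, which is zero because the loop starts at the
  angle zero. In the direction \<open>\<tau>\<close>, the change is the sum of a linear and a quadratic
  term in the radius \<open>l\<close> of the loop, so it vanishes for a suitable radius, which is
  nonzero if the linear coefficient is. The hypothesis on the increment of the control says precisely this.
\<close>
lemma shorter_competitor:
  fixes \<xi> :: "real^'p::finite^'q::finite" and u :: "real^'p"
  assumes \<tau>: "\<tau> \<noteq> 0" and L: "2 * pi / norm \<tau> < L" and u: "norm u = 1"
    and X0: "(outer (\<tau> /\<^sub>R norm \<tau>) u, 0) \<bullet> (extremal_control \<xi> \<eta> \<tau> L - (\<xi>, \<eta>)) \<noteq> 0"
  shows "\<exists>\<gamma> w. horizontal L \<gamma> w \<and> \<gamma> 0 = 0 \<and> \<gamma> L = extremal \<xi> \<eta> \<tau> L \<and>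
    horizontal_length L w < norm (\<xi>, \<eta>) * L"
proof -
  define A where "A = (Aop \<tau> :: ('q, 'p) layer1 \<Rightarrow> ('q, 'p) layer1)"
  define \<omega> where "\<omega> = norm \<tau>"
  define e where "e = \<tau> /\<^sub>R \<omega>"
  define E1 :: "('q, 'p) layer1" where "E1 = (outer e u, 0)"
  define E2 :: "('q, 'p) layer1" where "E2 = (0, u)"
  define zb where "zb = extremal_layer1 \<xi> \<eta> \<tau>"
  define wb where "wb = extremal_control \<xi> \<eta> \<tau>"
  define tb where "tb s = snd (extremal \<xi> \<eta> \<tau> s)" for s
  define c where "c = norm (\<xi>, \<eta>)"
  define \<nu> where "\<nu> = 2 * pi / L"
  define X where "X = E1 \<bullet> (wb L - (\<xi>, \<eta>))"
  \<comment> \<open>The radius at which the linear and the quadratic change of the component along \<open>\<tau>\<close> cancel.\<close>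
  define l where "l = \<nu> * X / (pi * \<omega> * (\<omega> - \<nu>))"
  let ?I = "{0..L}"
  have \<omega>: "\<omega> > 0" using \<tau> by (simp add: \<omega>_def)
  have e1: "norm e = 1" using \<omega> by (simp add: e_def \<omega>_def)
  have Lpos: "L > 0" using L \<omega> by (smt (verit) \<omega>_def divide_pos_pos pi_gt_zero)
  have \<nu>: "0 < \<nu>" "\<nu> < \<omega>" using L Lpos \<omega> by (auto simp: \<nu>_def \<omega>_def[symmetric] field_simps)
  have \<nu>L: "\<nu> * L = 2 * pi" using Lpos by (simp add: \<nu>_def)
  have X: "X \<noteq> 0" using X0 by (simp add: X_def E1_def wb_def e_def \<omega>_def)
  have l: "l \<noteq> 0" using X \<nu> \<omega> by (simp add: l_def)
  have c: "c > 0"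
  proof (rule ccontr)
    assume "\<not> c > 0"
    then have "norm (wb L) = 0" "norm (\<xi>, \<eta>) = 0" by (auto simp: c_def wb_def norm_extremal_control)
    then show False using X by (simp add: X_def)
  qed
  have AE1: "A E1 = - (\<omega> *\<^sub>R E2)" and AE2: "A E2 = \<omega> *\<^sub>R E1"
    using Aop_frame[OF \<tau>, of u] by (simp_all add: A_def E1_def E2_def e_def \<omega>_def)
  have lin: "A (x + y) = A x + A y" "A (x - y) = A x - A y" "A (r *\<^sub>R x) = r *\<^sub>R A x" "A (- x) = - A x" for x y r
    by (simp_all add: A_def Aop_simps)
  have ip: "E1 \<bullet> E1 = 1" "E2 \<bullet> E2 = 1" "E1 \<bullet> E2 = 0" "E2 \<bullet> E1 = 0"
    using u e1 by (simp_all add: E1_def E2_def inner_prod_def norm_outer power2_norm_eq_inner[symmetric])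
  define \<delta> where "\<delta> r = (l * (cos (\<nu> * r) - 1)) *\<^sub>R E1 + (l * sin (\<nu> * r)) *\<^sub>R E2" for r
  define d where "d r = (- (l * \<nu> * sin (\<nu> * r))) *\<^sub>R E1 + (l * \<nu> * cos (\<nu> * r)) *\<^sub>R E2" for r
  define b where "b r = (- (l * \<nu>\<^sup>2 * cos (\<nu> * r))) *\<^sub>R E1 + (- (l * \<nu>\<^sup>2 * sin (\<nu> * r))) *\<^sub>R E2" for r
  have \<delta>': "(\<delta> has_vector_derivative d r) (at r within Y)" for r Y
    unfolding \<delta>_def[abs_def] d_def has_vector_derivative_def
    by (auto intro!: derivative_eq_intros simp: algebra_simps)
  have d': "(d has_vector_derivative b r) (at r within Y)" for r Y
    unfolding d_def[abs_def] b_def has_vector_derivative_def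
    by (auto intro!: derivative_eq_intros simp: algebra_simps power2_eq_square)
  have b': "(b has_vector_derivative - (\<nu>\<^sup>2 *\<^sub>R d r)) (at r within Y)" for r Y
    unfolding b_def[abs_def] d_def has_vector_derivative_def
    by (auto intro!: derivative_eq_intros simp: algebra_simps power2_eq_square)
  have Ab: "A (b r) = (\<omega> * \<nu>) *\<^sub>R d r" for r
    by (simp add: b_def d_def lin AE1 AE2 algebra_simps power2_eq_square)
  have \<delta>Ad: "\<delta> r \<bullet> A (d r) = l\<^sup>2 * \<omega> * \<nu> * (1 - cos (\<nu> * r))" for r
  proof -
    have "\<delta> r \<bullet> A (d r) = l\<^sup>2 * \<omega> * \<nu> * ((cos (\<nu> * r))\<^sup>2 + (sin (\<nu> * r))\<^sup>2 - cos (\<nu> * r))"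
      by (simp add: \<delta>_def d_def lin AE1 AE2 inner_add_left inner_add_right inner_diff_left ip algebra_simps power2_eq_square
          del: sin_cos_squared_add sin_cos_squared_add2 sin_cos_squared_add3)
    then show ?thesis by simp
  qed
  have dd: "d r \<bullet> d r = l\<^sup>2 * \<nu>\<^sup>2" for r
  proof -
    have "d r \<bullet> d r = l\<^sup>2 * \<nu>\<^sup>2 * ((sin (\<nu> * r))\<^sup>2 + (cos (\<nu> * r))\<^sup>2)"
      by (simp add: d_def inner_add_left inner_add_right ip algebra_simps power2_eq_square
          del: sin_cos_squared_add sin_cos_squared_add2 sin_cos_squared_add3)
    then show ?thesis by simp
  qed
  have ends: "\<delta> 0 = 0" "\<delta> L = 0" "b L = - ((l * \<nu>\<^sup>2) *\<^sub>R E1)" "b 0 = - ((l * \<nu>\<^sup>2) *\<^sub>R E1)"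
    by (simp_all add: \<delta>_def b_def \<nu>L)
  have wb': "(wb has_vector_derivative - A (wb r)) (at r within Y)" for r Y
    unfolding wb_def A_def by (rule extremal_control_derivative)
  have zb': "(zb has_vector_derivative wb r) (at r within ?I)" if "r \<in> ?I" for r
    unfolding wb_def zb_def by (rule extremal_layer1_derivative[OF that])
  have tb': "(tb has_vector_derivative Qform (zb r) (wb r)) (at r within ?I)" if "r \<in> ?I" for r
    unfolding wb_def zb_def tb_def[abs_def] by (rule extremal_layer2_derivative[OF that])
  have wb0: "wb 0 = (\<xi>, \<eta>)" by (simp add: wb_def extremal_control_0)
  note der_inner = bounded_bilinear.has_vector_derivative[OF bounded_bilinear_inner]
  have bw': "((\<lambda>r. b r \<bullet> wb r) has_real_derivative \<nu> * (\<omega> - \<nu>) * (d r \<bullet> wb r)) (at r within Y)" for r Y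
  proof -
    have "((\<lambda>r. b r \<bullet> wb r) has_vector_derivative b r \<bullet> - A (wb r) + - (\<nu>\<^sup>2 *\<^sub>R d r) \<bullet> wb r) (at r within Y)"
      by (intro der_inner b' wb')
    moreover have "b r \<bullet> A (wb r) = - (A (b r) \<bullet> wb r)" unfolding A_def by (simp add: Aop_skew)
    ultimately show ?thesis
      by (simp add: has_real_derivative_iff_has_vector_derivative Ab algebra_simps power2_eq_square)
  qed
  have bw_end: "b L \<bullet> wb L - b 0 \<bullet> wb 0 = - (l * \<nu>\<^sup>2 * X)"
    by (simp add: ends X_def wb0 inner_diff_right algebra_simps)
  have lX: "l * \<nu> * X / (\<omega> - \<nu>) = pi * \<omega> * l\<^sup>2"
    using \<nu> \<omega> X by (simp add: l_def power2_eq_square divide_simps)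
  \<comment> \<open>The derivative of the change of the vertical component, apart from the exact derivative of \<open>Qform zb \<delta>\<close>.\<close>
  define g where "g r = 2 *\<^sub>R Qform (\<delta> r) (wb r) + Qform (\<delta> r) (d r)" for r
  have cont: "continuous_on Y \<delta>" "continuous_on Y d" "continuous_on Y wb" for Y
    using continuous_on_vector_derivative[OF \<delta>'] continuous_on_vector_derivative[OF d']
      continuous_on_vector_derivative[OF wb'] by auto
  have gc: "continuous_on Y g" for Y
    unfolding g_def[abs_def] by (intro continuous_intros bounded_bilinear.continuous_on[OF bounded_bilinear_Qform] cont)
  define H where "H r = integral {0..r} g" for r
  have H': "(H has_vector_derivative g r) (at r within ?I)" if "r \<in> ?I" for r
    unfolding H_def[abs_def] by (rule integral_has_vector_derivative[OF gc that])
  have \<sigma>H: "\<sigma> \<bullet> H L = F L - F 0" if "\<And>r. r \<in> ?I \<Longrightarrow> (F has_real_derivative \<sigma> \<bullet> g r) (at r within ?I)" for \<sigma> F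
  proof -
    have "(g has_integral H L) ?I" unfolding H_def by (intro integrable_integral integrable_continuous_real gc)
    then have "((\<lambda>r. \<sigma> \<bullet> g r) has_integral \<sigma> \<bullet> H L) ?I"
      using has_integral_linear[OF _ bounded_linear_inner_right, of g "H L" ?I \<sigma>] by (simp add: o_def)
    moreover have "((\<lambda>r. \<sigma> \<bullet> g r) has_integral F L - F 0) ?I"
      using Lpos that by (intro fundamental_theorem_of_calculus) (auto simp: has_real_derivative_iff_has_vector_derivative)
    ultimately show ?thesis by (rule has_integral_unique)
  qed
  have \<tau>H: "\<tau> \<bullet> H L = 0"
  proof -
    define F where "F r = - (\<delta> r \<bullet> wb r) + (b r \<bullet> wb r) / (\<nu> * (\<omega> - \<nu>)) + l\<^sup>2 * \<omega> / 2 * (\<nu> * r - sin (\<nu> * r))" for r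
    have "\<tau> \<bullet> H L = F L - F 0"
    proof (rule \<sigma>H)
      fix r
      have 1: "((\<lambda>r. \<delta> r \<bullet> wb r) has_real_derivative \<delta> r \<bullet> - A (wb r) + d r \<bullet> wb r) (at r within ?I)"
        unfolding has_real_derivative_iff_has_vector_derivative by (intro der_inner \<delta>' wb')
      have "(F has_real_derivative (- (\<delta> r \<bullet> - A (wb r) + d r \<bullet> wb r) + (\<nu> * (\<omega> - \<nu>) * (d r \<bullet> wb r)) / (\<nu> * (\<omega> - \<nu>))
          + l\<^sup>2 * \<omega> / 2 * (\<nu> - cos (\<nu> * r) * \<nu>))) (at r within ?I)"
        unfolding F_def[abs_def]
        by (intro DERIV_add DERIV_minus DERIV_cdivide DERIV_cmult 1 bw') (auto intro!: derivative_eq_intros)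
      moreover have "(\<nu> * (\<omega> - \<nu>) * (d r \<bullet> wb r)) / (\<nu> * (\<omega> - \<nu>)) = d r \<bullet> wb r"
        using \<nu> by simp
      moreover have "\<tau> \<bullet> g r = \<delta> r \<bullet> A (wb r) + 1/2 * (\<delta> r \<bullet> A (d r))"
        unfolding g_def by (simp add: inner_add_right inner_Qform A_def)
      then have "\<tau> \<bullet> g r = - (\<delta> r \<bullet> - A (wb r) + d r \<bullet> wb r) + d r \<bullet> wb r
          + l\<^sup>2 * \<omega> / 2 * (\<nu> - cos (\<nu> * r) * \<nu>)"
        by (simp add: \<delta>Ad field_simps)
      ultimately show "(F has_real_derivative \<tau> \<bullet> g r) (at r within ?I)" by simp
    qed
    also have "\<dots> = (b L \<bullet> wb L - b 0 \<bullet> wb 0) / (\<nu> * (\<omega> - \<nu>)) + l\<^sup>2 * \<omega> * pi"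
      by (simp add: F_def ends(1,2) \<nu>L diff_divide_distrib)
    also have "\<dots> = - (l * \<nu> * X / (\<omega> - \<nu>)) + l\<^sup>2 * \<omega> * pi"
      using \<nu> unfolding bw_end by (simp add: power2_eq_square)
    also have "\<dots> = 0" unfolding lX by simp
    finally show ?thesis .
  qed
  have \<sigma>H0: "\<sigma> \<bullet> H L = 0" if \<sigma>: "\<sigma> \<bullet> \<tau> = 0" for \<sigma>
  proof -
    have \<sigma>e: "\<sigma> \<bullet> e = 0" using \<sigma> by (simp add: e_def)
    define F where "F r = l * cos (\<nu> * r) / \<nu> * (\<sigma> \<bullet> (\<xi> *v u))" for r
    have "\<sigma> \<bullet> H L = F L - F 0"
    proof (rule \<sigma>H)
      fix r assume r: "r \<in> ?I"
      have "fst (wb r) = \<xi> - outer \<tau> (snd (zb r))"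
        using arg_cong[OF extremal_control_plus_Aop_layer1[of r \<xi> \<eta> \<tau>], of fst] r
        by (simp add: wb_def zb_def Aop_eq algebra_simps)
      then have "\<sigma> \<bullet> g r = - (l * sin (\<nu> * r)) * (\<sigma> \<bullet> (\<xi> *v u))"
        by (simp add: g_def Qform_def \<delta>_def d_def E1_def E2_def inner_add_right inner_diff_right
            outer_mult \<sigma>e \<sigma> matrix_vector_mult_diff_rdistrib scaleR_matrix_vector_assoc[symmetric]
            matrix_vector_mult_scaleR del: scaleR_minus_left)
      moreover have "(F has_real_derivative - (l * sin (\<nu> * r)) * (\<sigma> \<bullet> (\<xi> *v u))) (at r within ?I)"
        unfolding F_def[abs_def] using \<nu> by (auto intro!: derivative_eq_intros)
      ultimately show "(F has_real_derivative \<sigma> \<bullet> g r) (at r within ?I)" by simp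
    qed
    then show ?thesis by (simp add: F_def \<nu>L)
  qed
  \<comment> \<open>By the previous two steps, \<open>H L\<close> is orthogonal to \<open>\<tau>\<close>, hence to itself.\<close>
  have HL: "H L = 0"
    using \<sigma>H0[of "H L"] \<tau>H by (simp add: inner_commute)
  define \<gamma> where "\<gamma> r = (zb r + \<delta> r, tb r + Qform (zb r) (\<delta> r) + H r)" for r
  define w where "w r = wb r + d r" for r
  have wc: "continuous_on Y w" for Y unfolding w_def[abs_def] by (intro continuous_intros cont)
  have "horizontal L \<gamma> w"
  proof (rule horizontalI_C1[OF _ wc])
    fix r assume r: "r \<in> ?I"
    have "(\<gamma> has_vector_derivative (wb r + d r, Qform (zb r) (wb r) + (Qform (zb r) (d r) + Qform (wb r) (\<delta> r)) + g r)) (at r within ?I)"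
      unfolding \<gamma>_def[abs_def]
      by (intro has_vector_derivative_Pair has_vector_derivative_add zb' tb' \<delta>' H' r
          bounded_bilinear.has_vector_derivative[OF bounded_bilinear_Qform])
    moreover have "Qform (zb r) (wb r) + (Qform (zb r) (d r) + Qform (wb r) (\<delta> r)) + g r = Qform (fst (\<gamma> r)) (w r)"
      unfolding g_def \<gamma>_def w_def fst_conv Qform_antisym[of "wb r" "\<delta> r"]
      by (simp add: bounded_bilinear.add_left[OF bounded_bilinear_Qform]
          bounded_bilinear.add_right[OF bounded_bilinear_Qform] scaleR_2)
    ultimately show "(\<gamma> has_vector_derivative (w r, Qform (fst (\<gamma> r)) (w r))) (at r within ?I)"
      by (simp add: w_def)
  qed
  moreover have "\<gamma> 0 = 0"
    by (simp add: \<gamma>_def zb_def extremal_layer1_0 ends tb_def extremal_0 H_def zero_prod_def Qform_self)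
  moreover have "\<gamma> L = extremal \<xi> \<eta> \<tau> L"
    by (simp add: \<gamma>_def ends HL zb_def tb_def extremal_def bounded_bilinear.zero_right[OF bounded_bilinear_Qform])
  moreover have "horizontal_length L w < c * L"
  proof -
    have "horizontal_length L w = integral ?I (\<lambda>r. norm (w r))"
      unfolding horizontal_length_eq_norm
      by (rule lebesgue_integral_eq_integral[OF continuous_imp_integrable_real]) (auto intro!: continuous_intros wc)
    \<comment> \<open>The arithmetic-geometric inequality passes from the energy of the competitor, which is explicit, to its length.\<close>
    also have "\<dots> \<le> integral ?I (\<lambda>r. ((norm (w r))\<^sup>2 / c + c) / 2)"
    proof (rule integral_le)
      show "norm (w r) \<le> ((norm (w r))\<^sup>2 / c + c) / 2" for r
        using sum_squares_bound[of "norm (w r)" c] c by (simp add: field_simps power2_eq_square)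
    qed (use c in \<open>auto intro!: integrable_continuous_real continuous_intros wc\<close>)
    also have "\<dots> = c * L - pi * l\<^sup>2 * (\<omega> - \<nu>) / c"
    proof -
      define F where "F r = ((c\<^sup>2 + l\<^sup>2 * \<nu>\<^sup>2) * r + 2 * (b r \<bullet> wb r) / (\<nu> * (\<omega> - \<nu>))) / c / 2 + c * r / 2" for r
      have "((\<lambda>r. ((norm (w r))\<^sup>2 / c + c) / 2) has_integral F L - F 0) ?I"
      proof (rule fundamental_theorem_of_calculus)
        fix r
        have "(norm (w r))\<^sup>2 = (norm (wb r))\<^sup>2 + 2 * (d r \<bullet> wb r) + d r \<bullet> d r"
          unfolding w_def power2_norm_eq_inner by (simp add: inner_add_left inner_add_right inner_commute[of "wb r" "d r"])
        then have nw: "(norm (w r))\<^sup>2 = c\<^sup>2 + l\<^sup>2 * \<nu>\<^sup>2 + 2 * (d r \<bullet> wb r)"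
          by (simp add: wb_def norm_extremal_control c_def dd)
        have "(F has_real_derivative (((c\<^sup>2 + l\<^sup>2 * \<nu>\<^sup>2) * 1 + 2 * (\<nu> * (\<omega> - \<nu>) * (d r \<bullet> wb r)) / (\<nu> * (\<omega> - \<nu>))) / c / 2 + c * 1 / 2)) (at r within ?I)"
          unfolding F_def[abs_def] by (intro DERIV_add DERIV_cdivide DERIV_cmult bw' DERIV_ident)
        then show "(F has_vector_derivative ((norm (w r))\<^sup>2 / c + c) / 2) (at r within ?I)"
          using \<nu> unfolding nw add_divide_distrib[of _ c 2]
          by (simp add: has_real_derivative_iff_has_vector_derivative mult.commute)
      qed (use Lpos in simp)
      then have "integral ?I (\<lambda>r. ((norm (w r))\<^sup>2 / c + c) / 2) = F L - F 0" by (rule integral_unique)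
      also have "\<dots> = ((c\<^sup>2 + l\<^sup>2 * \<nu>\<^sup>2) * L + 2 * ((b L \<bullet> wb L - b 0 \<bullet> wb 0) / (\<nu> * (\<omega> - \<nu>)))) / c / 2 + c * L / 2"
        by (simp add: F_def diff_divide_distrib add_divide_distrib)
      also have "(b L \<bullet> wb L - b 0 \<bullet> wb 0) / (\<nu> * (\<omega> - \<nu>)) = - (l * \<nu> * X / (\<omega> - \<nu>))"
        using \<nu> unfolding bw_end by (simp add: power2_eq_square)
      also have "\<dots> = - (pi * \<omega> * l\<^sup>2)" unfolding lX ..
      also have "(c\<^sup>2 + l\<^sup>2 * \<nu>\<^sup>2) * L = c\<^sup>2 * L + l\<^sup>2 * \<nu> * (2 * pi)"
        unfolding \<nu>L[symmetric] by (simp add: power2_eq_square algebra_simps)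
      finally show ?thesis using c by (simp add: field_simps power2_eq_square)
    qed
    also have "\<dots> < c * L" using c l \<nu> by simp
    finally show ?thesis .
  qed
  ultimately show ?thesis unfolding c_def by blast
qed

text \<open>
  The expression is the increment of the control that has to be nonzero in the construction
  of a shorter curve, by \<open>inner_extremal_control_increment\<close>. With \<open>\<omega> L = 2 pi + 2 x\<close> it becomes
  \<open>- 2 sin x (\<alpha> sin x + \<beta> cos x)\<close>; the last factor cannot vanish both at \<open>y\<close> and at \<open>2 y\<close>
  for a small \<open>y > 0\<close>. The freedom to choose \<open>L\<close> is necessary: the endpoint \<open>s\<close> itself may be a multiple
  of the period, where the increment is zero.
\<close>
lemma loop_period_exists:
  fixes \<alpha> \<beta> \<omega> s :: real
  assumes \<omega>: "\<omega> > 0" and s: "2 * pi / \<omega> < s" and nz: "\<alpha> \<noteq> 0 \<or> \<beta> \<noteq> 0"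
  obtains L where "2 * pi / \<omega> < L" "L < s" "(cos (\<omega> * L) - 1) * \<alpha> - sin (\<omega> * L) * \<beta> \<noteq> 0"
proof -
  define K where "K = \<omega> * s - 2 * pi"
  define y where "y = min (K / 6) (pi / 8)"
  have "K > 0" using \<omega> s by (simp add: K_def divide_less_eq mult.commute)
  then have y: "0 < y" "y < pi / 4" "6 * y \<le> K"
    using pi_gt_zero by (auto simp: y_def min_def)
  define \<Lambda> where "\<Lambda> x = (2 * pi + 2 * x) / \<omega>" for x
  have 1: "(cos (\<omega> * \<Lambda> x) - 1) * \<alpha> - sin (\<omega> * \<Lambda> x) * \<beta> = - 2 * sin x * (\<alpha> * sin x + \<beta> * cos x)" for x
  proof -
    have "\<omega> * \<Lambda> x = 2 * x + 2 * pi" using \<omega> by (simp add: \<Lambda>_def)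
    then show ?thesis
      by (simp add: cos_double_sin sin_double) (simp add: power2_eq_square algebra_simps)
  qed
  have s0: "sin y > 0" "sin (2 * y) > 0" "cos y > 0"
    using y by (auto intro!: sin_gt_zero cos_gt_zero_pi)
  have "\<alpha> * sin y + \<beta> * cos y \<noteq> 0 \<or> \<alpha> * sin (2 * y) + \<beta> * cos (2 * y) \<noteq> 0"
  proof (rule ccontr)
    assume "\<not> ?thesis"
    then have z: "\<alpha> * sin y + \<beta> * cos y = 0" "\<alpha> * sin (2 * y) + \<beta> * cos (2 * y) = 0" by auto
    have "\<alpha> * sin (2 * y - y) = cos y * (\<alpha> * sin (2 * y) + \<beta> * cos (2 * y)) - cos (2 * y) * (\<alpha> * sin y + \<beta> * cos y)"
      unfolding sin_diff by (simp add: algebra_simps)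
    then have "\<alpha> = 0" using z s0 by simp
    then show False using z s0 nz by simp
  qed
  then obtain x where x: "x = y \<or> x = 2 * y" "\<alpha> * sin x + \<beta> * cos x \<noteq> 0" by blast
  show thesis
  proof (rule that[of "\<Lambda> x"])
    show "2 * pi / \<omega> < \<Lambda> x" using x y \<omega> by (auto simp: \<Lambda>_def divide_strict_right_mono)
    have "2 * pi + 2 * x < \<omega> * s" using x(1) y by (auto simp: K_def)
    then show "\<Lambda> x < s" using \<omega> by (simp add: \<Lambda>_def divide_less_eq mult.commute)
    show "(cos (\<omega> * \<Lambda> x) - 1) * \<alpha> - sin (\<omega> * \<Lambda> x) * \<beta> \<noteq> 0"
      unfolding 1 using x s0 by auto
  qed
qed

lemma inner_extremal_control_increment:
  fixes \<xi> :: "real^'p::finite^'q::finite"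
  assumes \<tau>: "\<tau> \<noteq> 0"
  shows "(outer (\<tau> /\<^sub>R norm \<tau>) u, 0) \<bullet> (extremal_control \<xi> \<eta> \<tau> L - (\<xi>, \<eta>)) =
    (cos (norm \<tau> * L) - 1) * ((\<tau> \<bullet> (\<xi> *v u)) / norm \<tau>) - sin (norm \<tau> * L) * (\<eta> \<bullet> u)"
proof -
  let ?A = "Aop \<tau> :: ('q, 'p) layer1 \<Rightarrow> _" and ?E = "(outer (\<tau> /\<^sub>R norm \<tau>) u, 0) :: ('q, 'p) layer1"
  have AE: "?A ?E = - (norm \<tau> *\<^sub>R (0, u))"
    by (rule Aop_frame[OF \<tau>])
  have 1: "?E \<bullet> ?A (\<xi>, \<eta>) = norm \<tau> * (\<eta> \<bullet> u)"
    using Aop_skew[of \<tau> ?E "(\<xi>, \<eta>)"] unfolding AE by (simp add: inner_commute)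
  have 2: "?E \<bullet> ?A (?A (\<xi>, \<eta>)) = - norm \<tau> * (\<tau> \<bullet> (\<xi> *v u))"
  proof -
    have "?E \<bullet> ?A (?A (\<xi>, \<eta>)) = - (?A ?E \<bullet> ?A (\<xi>, \<eta>))" by (simp add: Aop_skew)
    also have "\<dots> = - norm \<tau> * (\<tau> \<bullet> (\<xi> *v u))"
      unfolding AE by (simp add: Aop_eq dot_lmul_matrix inner_commute[of u])
    finally show ?thesis .
  qed
  have "?E \<bullet> (extremal_control \<xi> \<eta> \<tau> L - (\<xi>, \<eta>)) =
      ((1 - cos (norm \<tau> * L)) / (norm \<tau>)\<^sup>2) * (?E \<bullet> ?A (?A (\<xi>, \<eta>))) - (sin (norm \<tau> * L) / norm \<tau>) * (?E \<bullet> ?A (\<xi>, \<eta>))"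
    unfolding extremal_control_eq[OF \<tau>] by (simp only: inner_diff_right inner_add_right inner_scaleR_right)
  also have "\<dots> = (cos (norm \<tau> * L) - 1) * ((\<tau> \<bullet> (\<xi> *v u)) / norm \<tau>) - sin (norm \<tau> * L) * (\<eta> \<bullet> u)"
    unfolding 1 2 using \<tau> by (simp add: power2_eq_square field_simps)
  finally show ?thesis .
qed

text \<open>
  A shorter curve is available on some interval \<open>{0..L}\<close> with \<open>L < s\<close>; following it and
  then the extremal beats the extremal on \<open>{0..s}\<close>.
\<close>
lemma not_minimizing_beyond_period:
  fixes \<xi> :: "real^'p::finite^'q::finite"
  assumes \<tau>: "\<tau> \<noteq> 0" and A: "Aop \<tau> (\<xi>, \<eta>) \<noteq> 0" and s: "2 * pi / norm \<tau> < s"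
  shows "\<not> minimizes_length (extremal \<xi> \<eta> \<tau>) s"
proof
  assume min: "minimizes_length (extremal \<xi> \<eta> \<tau>) s"
  have "\<exists>i. (\<tau> v* \<xi>) $ i \<noteq> 0 \<or> \<eta> $ i \<noteq> 0"
  proof (rule ccontr)
    assume "\<not> ?thesis"
    then have "\<tau> v* \<xi> = 0" "\<eta> = 0" by (auto simp: vec_eq_iff)
    then show False using A by (simp add: outer_zero_right Aop_eq zero_prod_def)
  qed
  then obtain i where i: "(\<tau> v* \<xi>) $ i \<noteq> 0 \<or> \<eta> $ i \<noteq> 0" ..
  define u :: "real^'p" where "u = axis i 1"
  have u: "norm u = 1" "\<tau> \<bullet> (\<xi> *v u) = (\<tau> v* \<xi>) $ i" "\<eta> \<bullet> u = \<eta> $ i"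
    by (simp_all add: u_def dot_lmul_matrix[symmetric] inner_axis)
  have "(\<tau> \<bullet> (\<xi> *v u)) / norm \<tau> \<noteq> 0 \<or> \<eta> \<bullet> u \<noteq> 0" using i \<tau> by (simp add: u)
  from loop_period_exists[OF _ s this] \<tau> obtain L where L: "2 * pi / norm \<tau> < L" "L < s"
    and X: "(cos (norm \<tau> * L) - 1) * ((\<tau> \<bullet> (\<xi> *v u)) / norm \<tau>) - sin (norm \<tau> * L) * (\<eta> \<bullet> u) \<noteq> 0"
    by auto
  have pos: "0 < 2 * pi / norm \<tau>" using \<tau> by simp
  then have L0: "0 < L" and s0: "0 < s" using L by linarith+
  obtain \<gamma> w where \<gamma>: "horizontal L \<gamma> w" "\<gamma> 0 = 0" "\<gamma> L = extremal \<xi> \<eta> \<tau> L"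
    and len: "horizontal_length L w < norm (\<xi>, \<eta>) * L"
    using shorter_competitor[OF \<tau> L(1) u(1), of \<xi> \<eta>] X unfolding inner_extremal_control_increment[OF \<tau>] by blast
  let ?\<gamma> = "\<lambda>r. if r \<le> L then \<gamma> r else extremal \<xi> \<eta> \<tau> r"
  let ?w = "\<lambda>r. if r \<le> L then w r else extremal_control \<xi> \<eta> \<tau> r"
  note c = horizontal_concat[OF L0 L(2) \<gamma>(1) horizontal_extremal \<gamma>(3)]
  have "norm (\<xi>, \<eta>) * s \<le> horizontal_length s ?w"
    using min[unfolded minimizes_extremal_iff[OF s0], rule_format, of s ?\<gamma> ?w] c(1) s0 L0 L(2) \<gamma>(2) by auto
  moreover have "horizontal_length s ?w < norm (\<xi>, \<eta>) * s"
    using c(2) len L0 s0 by (simp add: horizontal_length_extremal)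
  ultimately show False by simp
qed

section \<open>Cut time and cut points\<close>

lemma minimizes_up_to_period:
  assumes "\<tau> \<noteq> 0"
  shows "minimizes_length (extremal \<xi> \<eta> \<tau>) (2 * pi / norm \<tau>)"
proof -
  have "0 < 2 * pi / norm \<tau>" using assms by simp
  from minimizes_extremal_iff[OF this] show ?thesis
    using length_lower_bound[OF assms] by blast
qed

lemma cut_time_eq_period:
  assumes \<tau>: "\<tau> \<noteq> 0" and A: "Aop \<tau> (\<xi>, \<eta>) \<noteq> 0"
  shows "cut_time \<xi> \<eta> \<tau> = ereal (2 * pi / norm \<tau>)"
  unfolding cut_time_def
proof (rule antisym)
  show "Sup (ereal ` {s. 0 < s \<and> minimizes_length (extremal \<xi> \<eta> \<tau>) s}) \<le> ereal (2 * pi / norm \<tau>)"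
    using not_minimizing_beyond_period[OF \<tau> A] by (intro Sup_least) (force simp: not_less[symmetric])
  show "ereal (2 * pi / norm \<tau>) \<le> Sup (ereal ` {s. 0 < s \<and> minimizes_length (extremal \<xi> \<eta> \<tau>) s})"
    using \<tau> minimizes_up_to_period[OF \<tau>] by (intro Sup_upper imageI) simp
qed

lemma cut_time_degenerate:
  assumes "Aop \<tau> (\<xi>, \<eta>) = 0"
  shows "cut_time \<xi> \<eta> \<tau> \<noteq> ereal t"
proof
  assume t: "cut_time \<xi> \<eta> \<tau> = ereal t"
  have "ereal (\<bar>t\<bar> + 1) \<le> cut_time \<xi> \<eta> \<tau>"
    unfolding cut_time_def using minimizes_degenerate[OF assms] by (intro Sup_upper imageI) simp
  then show False using t by simp
qed

theorem theorem1p1: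
  shows "(\<forall>(\<xi>::real^'p::finite^'q::finite) (\<eta>::real^'p) (\<tau>::real^'q).
            (\<xi>, \<eta>) \<noteq> 0 \<and> \<tau> \<noteq> 0 \<and> norm \<eta> + norm (Pproj \<tau> ** \<xi>) > 0 \<longrightarrow>
              minimizes_length (extremal \<xi> \<eta> \<tau>) (2 * pi / norm \<tau>) \<and>
              cut_time \<xi> \<eta> \<tau> = ereal (2 * pi / norm \<tau>)) \<and>
         (cut_points :: ('q, 'p) carnot set) =
           {extremal \<xi> \<eta> \<tau> (2 * pi / norm \<tau>) | \<xi> \<eta> \<tau>.
              (\<xi>, \<eta>) \<noteq> 0 \<and> \<tau> \<noteq> 0 \<and> norm \<eta> + norm (Pproj \<tau> ** \<xi>) > 0}"
proof (intro conjI allI impI)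
  fix \<xi> :: "real^'p^'q" and \<eta> :: "real^'p" and \<tau> :: "real^'q"
  assume *: "(\<xi>, \<eta>) \<noteq> 0 \<and> \<tau> \<noteq> 0 \<and> norm \<eta> + norm (Pproj \<tau> ** \<xi>) > 0"
  then show "minimizes_length (extremal \<xi> \<eta> \<tau>) (2 * pi / norm \<tau>)"
    by (intro minimizes_up_to_period) simp
  from * show "cut_time \<xi> \<eta> \<tau> = ereal (2 * pi / norm \<tau>)"
    by (intro cut_time_eq_period) (auto simp: Aop_eq_0_iff)
next
  have finite_iff: "cut_time \<xi> \<eta> \<tau> = ereal t \<longleftrightarrow>
      \<tau> \<noteq> 0 \<and> norm \<eta> + norm (Pproj \<tau> ** \<xi>) > 0 \<and> t = 2 * pi / norm \<tau>"
    for \<xi> :: "real^'p^'q" and \<eta> :: "real^'p" and \<tau> :: "real^'q" and t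
  proof (cases "Aop \<tau> (\<xi>, \<eta>) = 0")
    case True
    then have "\<not> (\<tau> \<noteq> 0 \<and> norm \<eta> + norm (Pproj \<tau> ** \<xi>) > 0)" by (metis Aop_eq_0_iff)
    then show ?thesis using cut_time_degenerate[OF True] by blast
  next
    case False
    then have \<tau>: "\<tau> \<noteq> 0" using Aop_zero by metis
    then have "norm \<eta> + norm (Pproj \<tau> ** \<xi>) > 0" using False by (metis Aop_eq_0_iff)
    then show ?thesis using \<tau> cut_time_eq_period[OF \<tau> False] by auto
  qed
  show "(cut_points :: ('q, 'p) carnot set) =
      {extremal \<xi> \<eta> \<tau> (2 * pi / norm \<tau>) | \<xi> \<eta> \<tau>.
        (\<xi>, \<eta>) \<noteq> 0 \<and> \<tau> \<noteq> 0 \<and> norm \<eta> + norm (Pproj \<tau> ** \<xi>) > 0}"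
    unfolding cut_points_def finite_iff by blast
qed

end
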